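(* Let $A_2\in\mathbf{C}^{n\times n}$, $B_2\in\mathbf{C}^{n\times m}$ be such that the antilinear system $x^+=A_2^{\#}x^{\#}+B_2^{\#}u^{\#}$ is controllable, and let $F_1\in\mathbf{C}^{p\times p}$. Let $N_0(s)$ and $D_0(s)$ be polynomial matrices of sizes $n\times m$ and $m\times m$ satisfying $$sN_0^{\#}(s)-A_2N_0(s)=B_2D_0(s)$$ and $$\mathrm{rank}\begin{bmatrix} N_0(s) & -N_0(-s) \\ D_0(s) & -D_0(-s) \\ N_0^{\#}(s) & N_0^{\#}(-s) \\ D_0^{\#}(s) & D_0^{\#}(-s) \end{bmatrix}=2m,\quad\forall s\in\mathbf{C},$$ and write $\begin{bmatrix} N_0(s) \\ D_0(s) \end{bmatrix}=\sum_{i=0}^{\omega}\begin{bmatrix} N_{0,i} \\ D_{0,i} \end{bmatrix}s^i$. Then complete solutions $(X_1,X_2,Y_1,Y_2)$, with $X_1,X_2\in\mathbf{C}^{n\times p}$ and $Y_1,Y_2\in\mathbf{C}^{m\times p}$, to the coupled matrix equations $$A_2^{\#}X_2+B_2^{\#}Y_2=X_1F_1,\qquad A_2^{\#}X_1^{\#}+B_2^{\#}Y_1^{\#}=X_2^{\#}F_1^{\#}$$ are given by $$\begin{bmatrix} X_1 \\ Y_1 \end{bmatrix}=\sum_{\substack{0\le i\le\omega \\ i\text{ even}}}\begin{bmatrix} N_{0,i} \\ D_{0,i} \end{bmatrix}Z_1F_1^i+\sum_{\substack{0\le i\le\omega \\ i\text{ odd}}}\begin{bmatrix} N_{0,i}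 \\ D_{0,i} \end{bmatrix}Z_2F_1^i,$$ $$\begin{bmatrix} X_2 \\ Y_2 \end{bmatrix}=\sum_{\substack{0\le i\le\omega \\ i\text{ even}}}\begin{bmatrix} N_{0,i}^{\#} \\ D_{0,i}^{\#} \end{bmatrix}Z_2F_1^i+\sum_{\substack{0\le i\le\omega \\ i\text{ odd}}}\begin{bmatrix} N_{0,i}^{\#} \\ D_{0,i}^{\#} \end{bmatrix}Z_1F_1^i,$$ where $Z_1,Z_2\in\mathbf{C}^{m\times p}$ are arbitrary matrices; that is, the solutions are exactly those of this form.
   Context: $A^{\#}$ denotes the entrywise complex conjugate of $A$. For a polynomial matrix $P(s)$, $s$ is treated as a real parameter when conjugating ($s^{\#}=s$), so $P^{\#}(s)$ is obtained by conjugating the coefficients only. Here $x^+$ denotes $\dot x(t)$ or $x(t+1)$; controllability of $x^+=A_2^{\#}x^{\#}+B_2^{\#}u^{\#}$ is equivalent to controllability of the matrix pair $\left(\begin{bmatrix} 0 & A_2^{\#} \\ A_2 & 0 \end{bmatrix},\begin{bmatrix} 0 & B_2^{\#} \\ B_2 & 0 \end{bmatrix}\right)$, i.e. $\mathrm{rank}\begin{bmatrix} sI_n & -A_2^{\#} & 0 & B_2^{\#} \\ -A_2 & sI_n & B_2 & 0 \end{bmatrix}=2n$ for all $s\in\mathbf{C}$. The coupled equations are the generalized Sylvester bimatrix equation of the antilinear system in the case $F_2=0_{p\times p}$. *)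

theory Defs
  imports Complex_Main "Jordan_Normal_Form.DL_Rank"
begin

datatype time_domain = Continuous_Time | Discrete_Time

text \<open>Controllability of the antilinear system \<open>x\<^sup>+ = P x\<^sup># + Q u\<^sup>#\<close> with state dimension \<open>dim_row P\<close> and
  input dimension \<open>dim_col Q\<close>, where \<open>x\<^sup>+\<close> is the derivative of \<open>x\<close> in continuous time and the
  successor state in discrete time: every state can be steered to every other state in finite time.
  In discrete time this is point-to-point controllability (not merely controllability to the
  origin); it is the notion that amounts to the rank condition of the associated matrix pair at
  every complex \<open>s\<close>, including \<open>s = 0\<close>.\<close>

fun antilinear_controllable :: "time_domain \<Rightarrow> complex mat \<Rightarrow> complex mat \<Rightarrow> bool" where
  "antilinear_controllable Continuous_Time P Q \<longleftrightarrow>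
    (\<forall>x0 \<in> carrier_vec (dim_row P). \<forall>x1 \<in> carrier_vec (dim_row P).
      \<exists>(T::real) (u :: real \<Rightarrow> complex vec) (x :: real \<Rightarrow> complex vec). T > 0 \<and>
        (\<forall>t \<in> {0..T}. u t \<in> carrier_vec (dim_col Q)) \<and>
        (\<forall>j < dim_col Q. continuous_on {0..T} (\<lambda>t. u t $ j)) \<and>
        (\<forall>t \<in> {0..T}. x t \<in> carrier_vec (dim_row P)) \<and>
        (\<forall>t \<in> {0..T}. \<forall>i < dim_row P. ((\<lambda>r. x r $ i) has_vector_derivative
            (P *\<^sub>v map_vec cnj (x t) + Q *\<^sub>v map_vec cnj (u t)) $ i) (at t within {0..T})) \<and>
        x 0 = x0 \<and> x T = x1)"
| "antilinear_controllable Discrete_Time P Q \<longleftrightarrow>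
    (\<forall>x0 \<in> carrier_vec (dim_row P). \<forall>x1 \<in> carrier_vec (dim_row P).
      \<exists>(T::nat) (u :: nat \<Rightarrow> complex vec) (x :: nat \<Rightarrow> complex vec).
        (\<forall>t < T. u t \<in> carrier_vec (dim_col Q)) \<and>
        (\<forall>t < T. x (Suc t) = P *\<^sub>v map_vec cnj (x t) + Q *\<^sub>v map_vec cnj (u t)) \<and>
        x 0 = x0 \<and> x T = x1)"

abbreviation conj_mat :: "complex mat \<Rightarrow> complex mat" where
  "conj_mat A \<equiv> map_mat cnj A"

text \<open>The indeterminate is treated as real: only the coefficients are conjugated.\<close>

abbreviation conj_pmat :: "complex poly mat \<Rightarrow> complex poly mat" where
  "conj_pmat P \<equiv> map_mat (map_poly cnj) P"

abbreviation const_pmat :: "'a::zero mat \<Rightarrow> 'a poly mat" where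
  "const_pmat A \<equiv> map_mat (\<lambda>a. [:a:]) A"

abbreviation eval_pmat :: "'a::comm_semiring_0 poly mat \<Rightarrow> 'a \<Rightarrow> 'a mat" where
  "eval_pmat P s \<equiv> map_mat (\<lambda>q. poly q s) P"

abbreviation coeff_pmat :: "'a::zero poly mat \<Rightarrow> nat \<Rightarrow> 'a mat" where
  "coeff_pmat P i \<equiv> map_mat (\<lambda>q. coeff q i) P"

definition finsum_mat :: "nat \<Rightarrow> nat \<Rightarrow> ('b \<Rightarrow> 'a::semiring_1 mat) \<Rightarrow> 'b set \<Rightarrow> 'a mat" where
  "finsum_mat nr nc f I = finsum (module_mat TYPE('a) nr nc) f I"

end

theory Submission
  imports Defs "HOL-Analysis.Derivative" "Jordan_Normal_Form.Schur_Decomposition"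
begin

text \<open>Stack the unknowns as \<open>V\<^sub>1 = [X\<^sub>1; Y\<^sub>1]\<close>, \<open>V\<^sub>2 = [X\<^sub>2; Y\<^sub>2]\<close> and put \<open>C = [A\<^sub>2 B\<^sub>2]\<close>, \<open>E = [I 0]\<close>.
  After conjugating the second equation the system reads \<open>C V\<^sub>1 = E V\<^sub>2 F\<close>, \<open>C\<^sup># V\<^sub>2 = E V\<^sub>1 F\<close>, and
  comparing coefficients in the factorization shows by telescoping that every matrix of the stated
  form solves it.
  Conversely, bring \<open>F\<close> to upper triangular form and eliminate the columns of \<open>(V\<^sub>1, V\<^sub>2)\<close> from left to
  right: the first nonzero column lies in the kernel of a \<open>2n \<times> 2(n + m)\<close> pencil at the corresponding
  eigenvalue \<open>s\<close>. Controllability makes that pencil surjective, so its kernel has dimension \<open>2m\<close>; by the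
  rank hypothesis it is the range of the \<open>2m\<close> columns built from \<open>N\<^sub>0(\<plusminus>s)\<close> and \<open>D\<^sub>0(\<plusminus>s)\<close>, which
  supplies one column of \<open>Z\<^sub>1\<close> and \<open>Z\<^sub>2\<close>.\<close>

unbundle no vec_syntax and no inner_syntax
hide_const (open) Finite_Cartesian_Product.mat Finite_Cartesian_Product.vec Finite_Cartesian_Product.row
hide_type (open) Finite_Cartesian_Product.vec

section \<open>Controllability and the left kernel\<close>

text \<open>A left null vector \<open>(v, w)\<close> of the pencil turns \<open>v \<bullet> x + w \<bullet> x\<^sup>#\<close> into a quantity that the inputs
  cannot influence: along trajectories it is multiplied by \<open>s\<close>, respectively has derivative \<open>s\<close> times
  itself, so it stays \<open>0\<close> when started at the origin.\<close>

lemma antilinear_functional_step: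
  fixes P Q :: "complex mat"
  assumes P: "P \<in> carrier_mat n n" and Q: "Q \<in> carrier_mat n m"
    and v: "v \<in> carrier_vec n" and w: "w \<in> carrier_vec n"
    and PT: "transpose_mat P *\<^sub>v v = s \<cdot>\<^sub>v w" "transpose_mat (conj_mat P) *\<^sub>v w = s \<cdot>\<^sub>v v"
    and QT: "transpose_mat Q *\<^sub>v v = 0\<^sub>v m" "transpose_mat (conj_mat Q) *\<^sub>v w = 0\<^sub>v m"
    and x: "x \<in> carrier_vec n" and u: "u \<in> carrier_vec m"
  defines "y \<equiv> P *\<^sub>v map_vec cnj x + Q *\<^sub>v map_vec cnj u"
  shows "v \<bullet> y + w \<bullet> map_vec cnj y = s * (v \<bullet> x + w \<bullet> map_vec cnj x)"
proof -
  have cnj_mv: "map_vec cnj (A *\<^sub>v map_vec cnj z) = conj_mat A *\<^sub>v z"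
    if "A \<in> carrier_mat n k" "z \<in> carrier_vec k" for A z k
    using that by (intro eq_vecI) (auto simp: scalar_prod_def)
  have "map_vec cnj y = map_vec cnj (P *\<^sub>v map_vec cnj x) + map_vec cnj (Q *\<^sub>v map_vec cnj u)"
    unfolding y_def using P Q by (intro eq_vecI) auto
  then have cy: "map_vec cnj y = conj_mat P *\<^sub>v x + conj_mat Q *\<^sub>v u"
    using cnj_mv[OF P x] cnj_mv[OF Q u] by simp
  have "v \<bullet> y = v \<bullet> (P *\<^sub>v map_vec cnj x) + v \<bullet> (Q *\<^sub>v map_vec cnj u)"
    unfolding y_def by (rule scalar_prod_add_distrib[OF v]) (use P Q x u in auto)
  \<comment> \<open>Transposition moves \<open>P\<close> onto \<open>v\<close>, and the null vector
    equation replaces the result by \<open>s\<close> times \<open>w\<close>. The plain summand at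
    \<open>y\<close> thus comes from the conjugated summand at \<open>x\<close>; for
    \<open>w\<close> below it is the other way round.\<close>
  also have "v \<bullet> (P *\<^sub>v map_vec cnj x) = s * (w \<bullet> map_vec cnj x)"
    using transpose_vec_mult_scalar[OF P _ v, of "map_vec cnj x"] x w by (simp add: PT)
  also have "v \<bullet> (Q *\<^sub>v map_vec cnj u) = 0"
    using transpose_vec_mult_scalar[OF Q _ v, of "map_vec cnj u"] u by (simp add: QT)
  finally have 1: "v \<bullet> y = s * (w \<bullet> map_vec cnj x)" by simp
  have P': "conj_mat P \<in> carrier_mat n n" and Q': "conj_mat Q \<in> carrier_mat n m"
    using P Q by auto
  have "w \<bullet> map_vec cnj y = w \<bullet> (conj_mat P *\<^sub>v x) + w \<bullet> (conj_mat Q *\<^sub>v u)"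
    unfolding cy by (rule scalar_prod_add_distrib[OF w]) (use P' Q' x u in auto)
  also have "w \<bullet> (conj_mat P *\<^sub>v x) = s * (v \<bullet> x)"
    using transpose_vec_mult_scalar[OF P' x w] x v by (simp add: PT)
  also have "w \<bullet> (conj_mat Q *\<^sub>v u) = 0"
    using transpose_vec_mult_scalar[OF Q' u w] u by (simp add: QT)
  finally show ?thesis by (simp add: 1 algebra_simps)
qed

text \<open>Multiplying by the integrating factor \<open>exp (t *\<^sub>R (- s))\<close> gives a
  function with zero derivative on the interval, hence a constant. It is 0 at time 0, and the
  exponential never vanishes.\<close>

lemma linear_ode_zero:
  fixes f :: "real \<Rightarrow> complex"
  assumes T: "T > 0" and 0: "f 0 = 0"
    and f: "\<And>t. t \<in> {0..T} \<Longrightarrow> (f has_vector_derivative s * f t) (at t within {0..T})"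
  shows "f T = 0"
proof -
  have "((\<lambda>t. exp (t *\<^sub>R (- s)) * f t) has_vector_derivative 0) (at t within {0..T})"
    if "t \<in> {0..T}" for t
    using has_vector_derivative_mult[OF exp_scaleR_has_vector_derivative_right f[OF that]]
    by (rule has_vector_derivative_eq_rhs) (simp add: algebra_simps)
  from has_vector_derivative_zero_constant[OF convex_real_interval(5) this]
  obtain c where "\<And>t. t \<in> {0..T} \<Longrightarrow> exp (t *\<^sub>R (- s)) * f t = c" by blast
  from this[of 0] this[of T] show ?thesis using T 0 by simp
qed

text \<open>Controllability supplies a trajectory from the origin, where the functional is 0, to the
  prescribed \<open>y\<close>. The functional evolves by a homogeneous linear law, so it is still 0
  on arrival.\<close>

lemma antilinear_functional_vanishes:
  fixes P Q :: "complex mat"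
  assumes ctrl: "antilinear_controllable \<tau> P Q"
    and P: "P \<in> carrier_mat n n" and Q: "Q \<in> carrier_mat n m"
    and v: "v \<in> carrier_vec n" and w: "w \<in> carrier_vec n"
    and PT: "transpose_mat P *\<^sub>v v = s \<cdot>\<^sub>v w" "transpose_mat (conj_mat P) *\<^sub>v w = s \<cdot>\<^sub>v v"
    and QT: "transpose_mat Q *\<^sub>v v = 0\<^sub>v m" "transpose_mat (conj_mat Q) *\<^sub>v w = 0\<^sub>v m"
    and y: "y \<in> carrier_vec n"
  shows "v \<bullet> y + w \<bullet> map_vec cnj y = 0"
proof -
  define g where "g x = v \<bullet> x + w \<bullet> map_vec cnj x" for x
  note step = antilinear_functional_step[OF P Q v w PT QT, folded g_def]
  have g0: "g (0\<^sub>v n) = 0" using v w by (simp add: g_def scalar_prod_def)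
  have "g y = 0"
  proof (cases \<tau>)
    case Discrete_Time
    from ctrl[unfolded Discrete_Time antilinear_controllable.simps, rule_format, of "0\<^sub>v n" y] y P Q
    obtain T u x where u: "\<And>t. t < T \<Longrightarrow> u t \<in> carrier_vec m"
      and x: "\<And>t. t < T \<Longrightarrow> x (Suc t) = P *\<^sub>v map_vec cnj (x t) + Q *\<^sub>v map_vec cnj (u t)"
      and ends: "x 0 = 0\<^sub>v n" "x (T::nat) = y" by auto
    \<comment> \<open>The discrete-time definition does not state the dimension of intermediate
      states, so it is carried along in the induction.\<close>
    have "x t \<in> carrier_vec n \<and> g (x t) = 0" if "t \<le> T" for t
      using that
    proof (induction t)
      case 0
      then show ?case using ends g0 by simp
    next
      case (Suc t)
      then show ?case using step[of "x t" "u t"] x[of t] u[of t] P Q by auto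
    qed
    from this[of T] show ?thesis using ends by simp
  next
    case Continuous_Time
    have dims: "dim_row P = n" "dim_col Q = m" using P Q by auto
    from ctrl[unfolded Continuous_Time antilinear_controllable.simps dims, THEN bspec, THEN bspec,
        OF zero_carrier_vec y]
    obtain T u x where T: "(T::real) > 0" and u: "\<And>t. t \<in> {0..T} \<Longrightarrow> u t \<in> carrier_vec m"
      and xc: "\<And>t. t \<in> {0..T} \<Longrightarrow> x t \<in> carrier_vec n"
      and x: "\<And>t i. t \<in> {0..T} \<Longrightarrow> i < n \<Longrightarrow> ((\<lambda>r. x r $ i) has_vector_derivative
            (P *\<^sub>v map_vec cnj (x t) + Q *\<^sub>v map_vec cnj (u t)) $ i) (at t within {0..T})"
      and ends: "x 0 = 0\<^sub>v n" "x T = y"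
      by (elim exE conjE) blast
    \<comment> \<open>Derivatives along the trajectory are given coordinatewise, so the functional
      is written as a finite sum over coordinates before differentiating.\<close>
    have g_sum: "g z = (\<Sum>i<n. v $ i * z $ i + w $ i * cnj (z $ i))" if "z \<in> carrier_vec n" for z
      using that v w by (simp add: g_def scalar_prod_def sum.distrib atLeast0LessThan)
    define f where "f t = (\<Sum>i<n. v $ i * x t $ i + w $ i * cnj (x t $ i))" for t
    have fg: "f t = g (x t)" if "t \<in> {0..T}" for t
      using g_sum[OF xc[OF that]] by (simp add: f_def)
    have "(f has_vector_derivative s * f t) (at t within {0..T})" if t: "t \<in> {0..T}" for t
    proof -
      \<comment> \<open>\<open>z\<close> is the velocity at time \<open>t\<close>. Conjugation is
        real linear and commutes with differentiation in \<open>t\<close>, so the derivative of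
        \<open>f\<close> is the functional at \<open>z\<close>, which the one-step identity
        evaluates.\<close>
      define z where "z = P *\<^sub>v map_vec cnj (x t) + Q *\<^sub>v map_vec cnj (u t)"
      have z: "z \<in> carrier_vec n" using P Q xc[OF t] u[OF t] by (simp add: z_def)
      have "(f has_vector_derivative (\<Sum>i<n. v $ i * z $ i + w $ i * cnj (z $ i))) (at t within {0..T})"
        unfolding f_def
        by (intro has_vector_derivative_sum has_vector_derivative_add
            has_vector_derivative_mult_right has_vector_derivative_cnj)
          (use x[OF t] in \<open>auto simp: z_def\<close>)
      then show ?thesis
        using step[OF xc[OF t] u[OF t]] g_sum[OF z] fg[OF t] by (simp add: z_def)
    qed
    from linear_ode_zero[OF T _ this] fg[of 0] fg[of T] T ends g0 show ?thesis by simp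
  qed
  then show ?thesis by (simp add: g_def)
qed

text \<open>The functional vanishes on all states but is only real linear, so every coordinate is
  tested twice: the unit vector gives \<open>v $ j + w $ j = 0\<close>, and \<open>\<i>\<close>
  times it gives \<open>v $ j - w $ j = 0\<close>. This is full row rank of the pencil at
  \<open>s\<close>.\<close>

lemma controllable_left_kernel:
  fixes P Q :: "complex mat"
  assumes ctrl: "antilinear_controllable \<tau> P Q"
    and P: "P \<in> carrier_mat n n" and Q: "Q \<in> carrier_mat n m"
    and v: "v \<in> carrier_vec n" and w: "w \<in> carrier_vec n"
    and PT: "transpose_mat P *\<^sub>v v = s \<cdot>\<^sub>v w" "transpose_mat (conj_mat P) *\<^sub>v w = s \<cdot>\<^sub>v v"
    and QT: "transpose_mat Q *\<^sub>v v = 0\<^sub>v m" "transpose_mat (conj_mat Q) *\<^sub>v w = 0\<^sub>v m"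
  shows "v = 0\<^sub>v n \<and> w = 0\<^sub>v n"
proof -
  note vanish = antilinear_functional_vanishes[OF ctrl P Q v w PT QT]
  have "v $ j = 0 \<and> w $ j = 0" if j: "j < n" for j
  proof -
    have r: "map_vec cnj (c \<cdot>\<^sub>v unit_vec n j) = cnj c \<cdot>\<^sub>v unit_vec n j" for c
      by (intro eq_vecI) (auto simp: unit_vec_def)
    have "c * v $ j + cnj c * w $ j = 0" for c
      using vanish[of "c \<cdot>\<^sub>v unit_vec n j"] v w j by (simp add: r)
    from this[of 1] this[of \<i>] show ?thesis
      by (auto simp: add_eq_0_iff)
  qed
  then show ?thesis using v w by (auto intro!: eq_vecI)
qed

section \<open>Kernels of surjective matrices\<close>

text \<open>A nonzero kernel vector would be a linear dependence among the columns. Independence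
  speaks of the set of columns, so repetitions are excluded first: a maximal independent subset has
  \<open>nc\<close> elements, hence the set is as large as the list.\<close>

lemma (in vec_space) full_column_rank_inj:
  assumes A: "A \<in> carrier_mat n nc" and rank: "rank A = nc"
    and v: "v \<in> carrier_vec nc" and Av: "A *\<^sub>v v = 0\<^sub>v n"
  shows "v = 0\<^sub>v nc"
proof (rule ccontr)
  assume nz: "v \<noteq> 0\<^sub>v nc"
  obtain S where S: "maximal S (\<lambda>T. T \<subseteq> set (cols A) \<and> lin_indpt T)"
    using maximal_exists[of "(\<lambda>T. T \<subseteq> set (cols A) \<and> lin_indpt T)" "card (set (cols A))" "{}"]
    by (meson List.finite_set card_mono empty_iff empty_subsetI finite_lin_indpt2 rev_finite_subset)
  then have "card S \<le> card (set (cols A))" by (simp add: card_mono maximal_def)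
  then have "card (set (cols A)) \<ge> length (cols A)"
    using rank_card_indpt[OF A S] rank A by simp
  then have dist: "distinct (cols A)" by (intro card_distinct le_antisym card_length)
  show False
    using lin_depI[OF A v nz Av dist] full_rank_lin_indpt[OF A rank dist] by simp
qed

lemma mult_mat_zero_vec:
  fixes A :: "'a :: semiring_0 mat"
  assumes "A \<in> carrier_mat nr nc"
  shows "A *\<^sub>v 0\<^sub>v nc = 0\<^sub>v nr"
  using assms by (intro eq_vecI) auto

lemma zero_vec_append: "0\<^sub>v (k + l) = 0\<^sub>v k @\<^sub>v 0\<^sub>v l"
  by (intro eq_vecI) auto

lemma injective_square_solvable:
  fixes S :: "'a :: field mat"
  assumes S: "S \<in> carrier_mat k k" and v: "v \<in> carrier_vec k"
    and inj: "\<And>c. c \<in> carrier_vec k \<Longrightarrow> S *\<^sub>v c = 0\<^sub>v k \<Longrightarrow> c = 0\<^sub>v k"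
  obtains c where "c \<in> carrier_vec k" "v = S *\<^sub>v c"
proof -
  have "det S \<noteq> 0" using inj det_0_iff_vec_prod_zero_field[OF S] by blast
  then obtain B where B: "B \<in> carrier_mat k k" and SB: "S * B = 1\<^sub>m k"
    using det_non_zero_imp_unit[OF S, where b = "()"]
    by (auto simp: Units_def ring_mat_simps)
  have "v = S *\<^sub>v (B *\<^sub>v v)" using S B v SB by (simp flip: assoc_mult_mat_vec)
  then show ?thesis using that[of "B *\<^sub>v v"] B v by auto
qed

text \<open>The columns of \<open>M\<^sup>*\<close> span a complement of the kernel of \<open>M\<close>, so that adjoining them to \<open>W\<close>
  gives an invertible square matrix.\<close>

lemma kernel_eq_range:
  fixes M W :: "complex mat"
  assumes M: "M \<in> carrier_mat k N" and W: "W \<in> carrier_mat N r" and N: "N = k + r"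
    and left: "\<And>u. u \<in> carrier_vec k \<Longrightarrow> transpose_mat M *\<^sub>v u = 0\<^sub>v N \<Longrightarrow> u = 0\<^sub>v k"
    and inj: "\<And>b. b \<in> carrier_vec r \<Longrightarrow> W *\<^sub>v b = 0\<^sub>v N \<Longrightarrow> b = 0\<^sub>v r"
    and MW: "\<And>b. b \<in> carrier_vec r \<Longrightarrow> M *\<^sub>v (W *\<^sub>v b) = 0\<^sub>v k"
    and v: "v \<in> carrier_vec N" and Mv: "M *\<^sub>v v = 0\<^sub>v k"
  obtains b where "b \<in> carrier_vec r" "v = W *\<^sub>v b"
proof -
  note M = M[unfolded N] and W = W[unfolded N] and left = left[unfolded N] and inj = inj[unfolded N]
    and v = v[unfolded N]
  define M' where "M' = conj_mat (transpose_mat M)"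
  have M': "M' \<in> carrier_mat (k + r) k" using M by (simp add: M'_def)
  \<comment> \<open>The product of \<open>M\<close> with its adjoint \<open>M'\<close> is injective:
    \<open>M' *\<^sub>v a\<close> has squared norm 0, so it vanishes, and then the conjugate of
    \<open>a\<close> lies in the trivial left kernel of \<open>M\<close>.\<close>
  have MM': "a = 0\<^sub>v k" if a: "a \<in> carrier_vec k" and 0: "M *\<^sub>v (M' *\<^sub>v a) = 0\<^sub>v k" for a
  proof -
    define y where "y = M' *\<^sub>v a"
    have y: "y \<in> carrier_vec (k + r)" using M' a by (simp add: y_def)
    have cy: "conjugate y = transpose_mat M *\<^sub>v conjugate a"
      using M a by (intro eq_vecI) (auto simp: y_def M'_def scalar_prod_def)
    have "y \<bullet>c y = conjugate a \<bullet> (M *\<^sub>v y)"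
      using transpose_vec_mult_scalar[OF M y, of "conjugate a"] a y M
      by (simp add: cy comm_scalar_prod[of _ "k + r"])
    also have "\<dots> = 0" using 0 a by (simp add: y_def)
    finally have "conjugate y = 0\<^sub>v (k + r)" using y by simp
    then have "conjugate a = 0\<^sub>v k" using left[of "conjugate a"] a by (simp add: cy)
    then show ?thesis using a by (metis conjugate_zero_vec conjugate_id)
  qed
  \<comment> \<open>This is \<open>[M' W]\<close>, with empty lower blocks so that block
    multiplication applies; it is square because \<open>N = k + r\<close>.\<close>
  define S where "S = four_block_mat M' W (0\<^sub>m 0 k) (0\<^sub>m 0 r)"
  have S: "S \<in> carrier_mat (k + r) (k + r)" using M' W by (auto simp: S_def)
  have SV: "S *\<^sub>v (a @\<^sub>v b) = M' *\<^sub>v a + W *\<^sub>v b" if "a \<in> carrier_vec k" "b \<in> carrier_vec r" for a b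
    unfolding S_def four_block_mat_mult_vec[OF M' W zero_carrier_mat zero_carrier_mat that]
    using M' W that by (intro eq_vecI) auto
  \<comment> \<open>\<open>M\<close> annihilates the \<open>W\<close> part. This is used twice: for
    the injectivity of \<open>S\<close>, and at the end to remove the \<open>M'\<close> part from
    the representation of \<open>v\<close>.\<close>
  have MS: "a = 0\<^sub>v k" if a: "a \<in> carrier_vec k" and b: "b \<in> carrier_vec r"
    and 0: "M *\<^sub>v (M' *\<^sub>v a + W *\<^sub>v b) = 0\<^sub>v k" for a b
  proof (rule MM'[OF a])
    have "M *\<^sub>v (M' *\<^sub>v a) + 0\<^sub>v k = 0\<^sub>v k"
      using 0 mult_add_distrib_mat_vec[OF M, of "M' *\<^sub>v a" "W *\<^sub>v b"] M' W a b MW[OF b] by simp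
    then show "M *\<^sub>v (M' *\<^sub>v a) = 0\<^sub>v k" using M M' a by simp
  qed
  have split: "\<exists>a b. c = a @\<^sub>v b \<and> a \<in> carrier_vec k \<and> b \<in> carrier_vec r"
    if "c \<in> carrier_vec (k + r)" for c :: "complex vec"
    using that vec_first_last_append by (metis vec_first_carrier vec_last_carrier)
  have "c = 0\<^sub>v (k + r)" if c: "c \<in> carrier_vec (k + r)" and 0: "S *\<^sub>v c = 0\<^sub>v (k + r)" for c
  proof -
    from split[OF c] obtain a b where ab: "c = a @\<^sub>v b" "a \<in> carrier_vec k" "b \<in> carrier_vec r"
      by blast
    have eq: "M' *\<^sub>v a + W *\<^sub>v b = 0\<^sub>v (k + r)" using SV[OF ab(2,3)] 0 ab(1) by simp
    have a0: "a = 0\<^sub>v k" by (rule MS[OF ab(2,3)]) (use eq M in \<open>simp add: mult_mat_zero_vec\<close>)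
    have "W *\<^sub>v b = 0\<^sub>v (k + r)" using eq W M' ab(3) by (simp add: a0 mult_mat_zero_vec)
    from inj[OF ab(3) this] show ?thesis using ab(1) a0 by auto
  qed
  from injective_square_solvable[OF S v this]
  obtain c where c: "c \<in> carrier_vec (k + r)" and vc: "v = S *\<^sub>v c" by blast
  from split[OF c] obtain a b where ab: "c = a @\<^sub>v b" "a \<in> carrier_vec k" "b \<in> carrier_vec r"
    by blast
  have eq: "v = M' *\<^sub>v a + W *\<^sub>v b" using SV[OF ab(2,3)] vc ab(1) by simp
  have "a = 0\<^sub>v k" using MS[OF ab(2,3)] Mv eq by simp
  then have "v = W *\<^sub>v b" using eq W M' ab(3) by (simp add: mult_mat_zero_vec)
  then show ?thesis using that ab(3) by blast
qed

section \<open>Sums of the form \<open>\<Sum>\<^sub>i K\<^sub>i Z\<^sub>i F\<^sup>i\<close>\<close>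

lemma finsum_mat_carrier:
  fixes f :: "'b \<Rightarrow> 'a::comm_ring_1 mat"
  assumes "\<And>i. i \<in> I \<Longrightarrow> f i \<in> carrier_mat nr nc"
  shows "finsum_mat nr nc f I \<in> carrier_mat nr nc"
proof -
  interpret abelian_group "module_mat TYPE('a) nr nc" by (rule abelian_group_mat)
  show ?thesis
    using finsum_closed[of f I] assms by (auto simp: finsum_mat_def module_mat_simps)
qed

lemma finsum_mat_empty: "finsum_mat nr nc (f :: 'b \<Rightarrow> 'a::comm_ring_1 mat) {} = 0\<^sub>m nr nc"
proof -
  interpret abelian_group "module_mat TYPE('a) nr nc" by (rule abelian_group_mat)
  show ?thesis using finsum_empty by (simp add: finsum_mat_def module_mat_simps)
qed

lemma finsum_mat_insert:
  fixes f :: "'b \<Rightarrow> 'a::comm_ring_1 mat"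
  assumes "finite I" "j \<notin> I" "\<And>i. i \<in> insert j I \<Longrightarrow> f i \<in> carrier_mat nr nc"
  shows "finsum_mat nr nc f (insert j I) = f j + finsum_mat nr nc f I"
proof -
  interpret abelian_group "module_mat TYPE('a) nr nc" by (rule abelian_group_mat)
  show ?thesis
    using finsum_insert[of I j f] assms by (auto simp: finsum_mat_def module_mat_simps)
qed

lemma finsum_mat_index:
  fixes f :: "'b \<Rightarrow> 'a::comm_ring_1 mat"
  assumes "finite I" "\<And>i. i \<in> I \<Longrightarrow> f i \<in> carrier_mat nr nc" "a < nr" "b < nc"
  shows "finsum_mat nr nc f I $$ (a, b) = (\<Sum>i\<in>I. f i $$ (a, b))"
  using assms
proof (induction I)
  case empty
  then show ?case by (simp add: finsum_mat_empty)
next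
  case (insert j I)
  have "finsum_mat nr nc f I \<in> carrier_mat nr nc" by (rule finsum_mat_carrier) (use insert in auto)
  then show ?case using finsum_mat_insert[OF insert(1,2), of f nr nc] insert by simp
qed

lemma index_mult_mat_sum:
  assumes "A \<in> carrier_mat nr n" "B \<in> carrier_mat n nc" "a < nr" "b < nc"
  shows "(A * B) $$ (a, b) = (\<Sum>l<n. A $$ (a, l) * B $$ (l, b))"
  using assms by (simp add: scalar_prod_def atLeast0LessThan)

text \<open>In the product of \<open>U ^\<^sub>m i\<close> and \<open>U\<close>, summands with
  \<open>l < r\<close> vanish by the induction hypothesis and those with \<open>l > r\<close> by
  triangularity, as \<open>b \<le> r\<close>. Only the diagonal position \<open>l = r\<close>
  survives.\<close>

lemma upper_triangular_pow:
  fixes U :: "'a::comm_ring_1 mat"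
  assumes U: "U \<in> carrier_mat p p" "upper_triangular U" and r: "r < p"
  shows "b \<le> r \<Longrightarrow> (U ^\<^sub>m i) $$ (r, b) = (if b = r then (U $$ (r, r)) ^ i else 0)"
proof (induction i arbitrary: b)
  case 0
  then show ?case using U r by auto
next
  case (Suc i)
  have "(U ^\<^sub>m Suc i) $$ (r, b) = (\<Sum>l<p. (U ^\<^sub>m i) $$ (r, l) * U $$ (l, b))"
    using U r Suc.prems by (simp add: scalar_prod_def atLeast0LessThan)
  also have "\<dots> = (\<Sum>l<p. if l = r then (U $$ (r, r)) ^ i * U $$ (r, b) else 0)"
  proof (rule sum.cong[OF refl])
    fix l assume l: "l \<in> {..<p}"
    have "U $$ (l, b) = 0" if "r < l" using U l that Suc.prems by (intro upper_triangularD) auto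
    then show "(U ^\<^sub>m i) $$ (r, l) * U $$ (l, b) = (if l = r then (U $$ (r, r)) ^ i * U $$ (r, b) else 0)"
      using Suc.IH[of l] by (cases l r rule: linorder_cases) auto
  qed
  finally have "(U ^\<^sub>m Suc i) $$ (r, b) = (U $$ (r, r)) ^ i * U $$ (r, b)" using r by simp
  moreover have "U $$ (r, b) = 0" if "b \<noteq> r"
    using U r that Suc.prems by (intro upper_triangularD) auto
  ultimately show ?case by simp
qed

text \<open>Letting the middle factor depend on \<open>i\<close> merges the even and the odd sum of
  the theorem into one, with \<open>Z = alternate Z1 Z2\<close>. An index shift then swaps
  \<open>Z1\<close> and \<open>Z2\<close>, which is how the two unknowns get coupled.\<close>

definition power_sum ::
    "nat \<Rightarrow> nat \<Rightarrow> nat \<Rightarrow> (nat \<Rightarrow> complex mat) \<Rightarrow> (nat \<Rightarrow> complex mat) \<Rightarrow> complex mat \<Rightarrow> complex mat" where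
  "power_sum q p w K Z F = finsum_mat q p (\<lambda>i. K i * Z i * F ^\<^sub>m i) {..w}"

definition alternate :: "'a \<Rightarrow> 'a \<Rightarrow> nat \<Rightarrow> 'a" where
  "alternate x y i = (if even i then x else y)"

lemma alternate_Suc: "alternate x y (Suc i) = alternate y x i"
  by (simp add: alternate_def)

lemma alternate_carrier_mat:
  "A \<in> carrier_mat nr nc \<Longrightarrow> B \<in> carrier_mat nr nc \<Longrightarrow> alternate A B i \<in> carrier_mat nr nc"
  by (simp add: alternate_def)

lemma alternate_carrier_vec:
  "v \<in> carrier_vec k \<Longrightarrow> w \<in> carrier_vec k \<Longrightarrow> alternate v w i \<in> carrier_vec k"
  by (simp add: alternate_def)

context
  fixes q m p :: nat and K :: "nat \<Rightarrow> complex mat"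
  assumes K: "\<And>i. K i \<in> carrier_mat q m"
begin

lemma power_sum_carrier:
  assumes "\<And>i. Z i \<in> carrier_mat m p" "F \<in> carrier_mat p p"
  shows "power_sum q p w K Z F \<in> carrier_mat q p"
  unfolding power_sum_def by (rule finsum_mat_carrier) (meson K assms mult_carrier_mat pow_carrier_mat)

lemma power_sum_0:
  assumes "\<And>i. Z i \<in> carrier_mat m p" "F \<in> carrier_mat p p"
  shows "power_sum q p 0 K Z F = K 0 * Z 0"
proof -
  have "K 0 * Z 0 \<in> carrier_mat q p" by (rule mult_carrier_mat[OF K assms(1)])
  then show ?thesis
    using finsum_mat_insert[of "{}" 0 "\<lambda>i. K i * Z i * F ^\<^sub>m i" q p] assms(2)
    by (simp add: power_sum_def finsum_mat_empty right_mult_one_mat[of _ q p])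
qed

lemma power_sum_Suc:
  assumes "\<And>i. Z i \<in> carrier_mat m p" "F \<in> carrier_mat p p"
  shows "power_sum q p (Suc w) K Z F =
    power_sum q p w K Z F + K (Suc w) * Z (Suc w) * F ^\<^sub>m Suc w"
proof -
  have c: "K i * Z i * F ^\<^sub>m i \<in> carrier_mat q p" for i
    using K assms by (meson mult_carrier_mat pow_carrier_mat)
  have "power_sum q p (Suc w) K Z F =
      K (Suc w) * Z (Suc w) * F ^\<^sub>m Suc w + power_sum q p w K Z F"
    unfolding power_sum_def atMost_Suc by (rule finsum_mat_insert) (use c in \<open>auto simp del: pow_mat.simps\<close>)
  also have "\<dots> = power_sum q p w K Z F + K (Suc w) * Z (Suc w) * F ^\<^sub>m Suc w"
    by (rule comm_add_mat[OF c power_sum_carrier[OF assms]])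
  finally show ?thesis .
qed

lemma power_sum_add:
  assumes Z: "\<And>i. Z i \<in> carrier_mat m p" and Z': "\<And>i. Z' i \<in> carrier_mat m p"
    and F: "F \<in> carrier_mat p p"
  shows "power_sum q p w K (\<lambda>i. Z i + Z' i) F = power_sum q p w K Z F + power_sum q p w K Z' F"
proof -
  have c: "K i * Y i * F ^\<^sub>m i \<in> carrier_mat q p" if "\<And>i. Y i \<in> carrier_mat m p" for i and Y
    using K F that by (meson mult_carrier_mat pow_carrier_mat)
  have d: "K i * (Z i + Z' i) * F ^\<^sub>m i = K i * Z i * F ^\<^sub>m i + K i * Z' i * F ^\<^sub>m i" for i
    using mult_add_distrib_mat[OF K Z Z', of i i i]
      add_mult_distrib_mat[of "K i * Z i" q p "K i * Z' i" "F ^\<^sub>m i" p] K Z Z' F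
    by (metis mult_carrier_mat pow_carrier_mat)
  have ZZ: "\<And>i. Z i + Z' i \<in> carrier_mat m p" using Z Z' by auto
  note car = c[of Z, OF Z] c[of Z', OF Z'] c[of "\<lambda>i. Z i + Z' i", OF ZZ]
  show ?thesis
  proof (rule eq_matI)
    fix a b
    assume "a < dim_row (power_sum q p w K Z F + power_sum q p w K Z' F)"
      "b < dim_col (power_sum q p w K Z F + power_sum q p w K Z' F)"
    then have ab: "a < q" "b < p" using power_sum_carrier[of Z' F w, OF Z' F] by auto
    have "(K i * (Z i + Z' i) * F ^\<^sub>m i) $$ (a, b) =
        (K i * Z i * F ^\<^sub>m i) $$ (a, b) + (K i * Z' i * F ^\<^sub>m i) $$ (a, b)" for i
      unfolding d using car(2)[of i] ab by (subst index_add_mat(1)) (simp_all only: carrier_matD)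
    then show "power_sum q p w K (\<lambda>i. Z i + Z' i) F $$ (a, b) =
        (power_sum q p w K Z F + power_sum q p w K Z' F) $$ (a, b)"
      using power_sum_carrier[of Z' F w, OF Z' F] ab
      by (simp add: power_sum_def finsum_mat_index car sum.distrib)
  qed (use power_sum_carrier[of Z' F w, OF Z' F] power_sum_carrier[of "\<lambda>i. Z i + Z' i" F w, OF ZZ F] in auto)
qed

text \<open>Transports a representation for a triangular \<open>U\<close> back to a similar matrix
  \<open>F\<close>: the intertwining relation lets \<open>Q\<close> pass through every
  power.\<close>

lemma power_sum_intertwine:
  assumes Z: "\<And>i. Z i \<in> carrier_mat m p" and F: "F \<in> carrier_mat p p"
    and U: "U \<in> carrier_mat p p" and Q: "Q \<in> carrier_mat p p"
    and QF: "\<And>i. Q * F ^\<^sub>m i = U ^\<^sub>m i * Q"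
  shows "power_sum q p w K (\<lambda>i. Z i * Q) F = power_sum q p w K Z U * Q"
proof (induction w)
  have ZQ: "\<And>i. Z i * Q \<in> carrier_mat m p" by (rule mult_carrier_mat[OF Z Q])
  case 0
  show ?case
    using K[of 0] Z[of 0] Q by (simp add: power_sum_0[OF Z U] power_sum_0[OF ZQ F])
next
  have ZQ: "\<And>i. Z i * Q \<in> carrier_mat m p" by (rule mult_carrier_mat[OF Z Q])
  case (Suc w)
  define k where "k = Suc w"
  have Fk: "F ^\<^sub>m k \<in> carrier_mat p p" "U ^\<^sub>m k \<in> carrier_mat p p" using F U by auto
  have "K k * (Z k * Q) * F ^\<^sub>m k = K k * Z k * (Q * F ^\<^sub>m k)"
    using assoc_mult_mat[OF K[of k] Z[of k] Q]
      assoc_mult_mat[OF mult_carrier_mat[OF K[of k] Z[of k]] Q Fk(1)] by simp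
  also have "\<dots> = K k * Z k * U ^\<^sub>m k * Q"
    unfolding QF by (rule assoc_mult_mat[symmetric, OF mult_carrier_mat[OF K Z] Fk(2) Q])
  finally have s: "K k * (Z k * Q) * F ^\<^sub>m k = K k * Z k * U ^\<^sub>m k * Q" .
  have c: "K k * Z k * U ^\<^sub>m k \<in> carrier_mat q p" using K Z Fk by (meson mult_carrier_mat)
  show ?case
    unfolding power_sum_Suc[OF Z U] power_sum_Suc[OF ZQ F] Suc.IH s[unfolded k_def]
    using add_mult_distrib_mat[OF power_sum_carrier[OF Z U] c Q] by (simp add: k_def)
qed

text \<open>If \<open>Z i\<close> is supported on column \<open>k\<close>, its product with
  \<open>U ^\<^sub>m i\<close> reads only row \<open>k\<close> of the power. Up to column
  \<open>k\<close> that row has just the diagonal entry, so such a sum adjusts column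
  \<open>k\<close> without disturbing the columns to its left.\<close>

lemma power_sum_column:
  assumes z: "\<And>i. z i \<in> carrier_vec m" and U: "U \<in> carrier_mat p p" "upper_triangular U"
    and a: "a < q" and k: "k < p" and b: "b \<le> k"
  shows "power_sum q p w K (\<lambda>i. mat m p (\<lambda>(r, j). if j = k then z i $ r else 0)) U $$ (a, b) =
    (if b = k then (\<Sum>i\<le>w. (U $$ (k, k)) ^ i * (K i *\<^sub>v z i) $ a) else 0)"
proof -
  define Z where "Z i = mat m p (\<lambda>(r, j). if j = k then z i $ r else 0)" for i
  have Z: "Z i \<in> carrier_mat m p" for i by (simp add: Z_def)
  have KZ: "K i * Z i \<in> carrier_mat q p" for i by (rule mult_carrier_mat[OF K Z])
  have KZi: "(K i * Z i) $$ (a, l) = (if l = k then (K i *\<^sub>v z i) $ a else 0)" if "l < p" for i l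
  proof -
    have "(K i * Z i) $$ (a, l) = (\<Sum>r<m. K i $$ (a, r) * (if l = k then z i $ r else 0))"
      using K[of i] a that by (simp add: Z_def scalar_prod_def atLeast0LessThan)
    also have "\<dots> = (if l = k then (K i *\<^sub>v z i) $ a else 0)"
      using K[of i] z[of i] a by (simp add: scalar_prod_def atLeast0LessThan)
    finally show ?thesis .
  qed
  have "(K i * Z i * U ^\<^sub>m i) $$ (a, b) =
      (if b = k then (U $$ (k, k)) ^ i * (K i *\<^sub>v z i) $ a else 0)" for i
  proof -
    have "(K i * Z i * U ^\<^sub>m i) $$ (a, b) = (\<Sum>l<p. (K i * Z i) $$ (a, l) * (U ^\<^sub>m i) $$ (l, b))"
      by (rule index_mult_mat_sum[OF KZ]) (use U a b k in auto)
    also have "\<dots> = (\<Sum>l<p. if l = k then (K i *\<^sub>v z i) $ a * (U ^\<^sub>m i) $$ (k, b) else 0)"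
      by (intro sum.cong) (auto simp: KZi simp del: index_mult_mat)
    also have "\<dots> = (K i *\<^sub>v z i) $ a * (U ^\<^sub>m i) $$ (k, b)"
      using k by simp
    finally show ?thesis using upper_triangular_pow[OF U k b] by simp
  qed
  moreover have "K i * Z i * U ^\<^sub>m i \<in> carrier_mat q p" for i
    using KZ U by (meson mult_carrier_mat pow_carrier_mat)
  ultimately have "power_sum q p w K Z U $$ (a, b) =
      (if b = k then (\<Sum>i\<le>w. (U $$ (k, k)) ^ i * (K i *\<^sub>v z i) $ a) else 0)"
    using a b k by (simp add: power_sum_def finsum_mat_index)
  then show ?thesis by (simp add: Z_def[abs_def])
qed

end

text \<open>Telescoping: \<open>C\<close> kills the term of index 0 and turns term
  \<open>i + 1\<close> into \<open>E\<close> times the shifted term \<open>i\<close>, times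
  \<open>F\<close>. The left sum stops one power of \<open>F\<close> too early, so a boundary term
  with \<open>E * L w\<close> is added.\<close>

lemma power_sum_shift:
  assumes C: "C \<in> carrier_mat n q" and E: "E \<in> carrier_mat n q"
    and K: "\<And>i. K i \<in> carrier_mat q m" and L: "\<And>i. L i \<in> carrier_mat q m"
    and Z: "\<And>i. Z i \<in> carrier_mat m p" and F: "F \<in> carrier_mat p p"
    and rec0: "C * K 0 = 0\<^sub>m n m" and rec: "\<And>i. C * K (Suc i) = E * L i"
  shows "C * power_sum q p w K Z F + E * L w * Z (Suc w) * F ^\<^sub>m Suc w =
    E * power_sum q p w L (\<lambda>i. Z (Suc i)) F * F"
proof (induction w)
  case 0
  have "C * (K 0 * Z 0) = 0\<^sub>m n p"
    using rec0 assoc_mult_mat[OF C K[of 0] Z[of 0]] Z[of 0] by simp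
  moreover have "E * L 0 * Z (Suc 0) * (1\<^sub>m p * F) = E * (L 0 * Z (Suc 0)) * F"
    using assoc_mult_mat[OF E L[of 0] Z[of "Suc 0"]] F by simp
  moreover have "E * (L 0 * Z (Suc 0)) * F \<in> carrier_mat n p"
    using E L Z F by (meson mult_carrier_mat)
  ultimately show ?case
    using F by (simp add: power_sum_0[OF K Z F] power_sum_0[OF L Z F])
next
  case (Suc w)
  let ?S = "power_sum q p w K Z F" and ?T = "power_sum q p w L (\<lambda>i. Z (Suc i)) F"
  define k where "k = Suc w"
  have Fk: "F ^\<^sub>m k \<in> carrier_mat p p" using F by auto
  have S: "?S \<in> carrier_mat q p" by (rule power_sum_carrier[OF K Z F])
  have T: "?T \<in> carrier_mat q p" by (rule power_sum_carrier[OF L Z F])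
  have KZ: "K k * Z k * F ^\<^sub>m k \<in> carrier_mat q p" using K Z Fk by (meson mult_carrier_mat)
  have LZ: "L k * Z (Suc k) * F ^\<^sub>m k \<in> carrier_mat q p" using L Z Fk by (meson mult_carrier_mat)
  \<comment> \<open>\<open>CK\<close> identifies the new summand with the old boundary term, so the
    induction hypothesis applies; \<open>EL\<close> identifies the new boundary term with the new
    summand on the right.\<close>
  have CK: "C * (K k * Z k * F ^\<^sub>m k) = E * L w * Z k * F ^\<^sub>m k"
  proof -
    have "C * (K k * Z k * F ^\<^sub>m k) = C * (K k * Z k) * F ^\<^sub>m k"
      by (rule assoc_mult_mat[symmetric, OF C mult_carrier_mat[OF K Z] Fk])
    also have "C * (K k * Z k) = C * K k * Z k"
      by (rule assoc_mult_mat[symmetric, OF C K Z])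
    finally show ?thesis by (simp only: k_def rec)
  qed
  have EL: "E * (L k * Z (Suc k) * F ^\<^sub>m k) * F = E * L k * Z (Suc k) * F ^\<^sub>m Suc k"
  proof -
    have "E * (L k * Z (Suc k) * F ^\<^sub>m k) = E * L k * Z (Suc k) * F ^\<^sub>m k"
      using assoc_mult_mat[OF E mult_carrier_mat[OF L Z] Fk, of k "Suc k"]
        assoc_mult_mat[OF E L Z, of k "Suc k"] by simp
    moreover have "E * L k * Z (Suc k) \<in> carrier_mat n p" using E L Z by (meson mult_carrier_mat)
    ultimately show ?thesis using assoc_mult_mat[OF _ Fk F, of "E * L k * Z (Suc k)" n] by simp
  qed
  have c1: "E * L w * Z k * F ^\<^sub>m k \<in> carrier_mat n p" using E L Z Fk by (meson mult_carrier_mat)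
  have "C * power_sum q p k K Z F + E * L k * Z (Suc k) * F ^\<^sub>m Suc k =
      C * ?S + E * L w * Z k * F ^\<^sub>m k + E * (L k * Z (Suc k) * F ^\<^sub>m k) * F"
    using mult_add_distrib_mat[OF C S KZ]
    by (simp add: power_sum_Suc[OF K Z F] k_def CK[unfolded k_def] EL[unfolded k_def] del: pow_mat.simps)
  also have "\<dots> = E * ?T * F + E * (L k * Z (Suc k) * F ^\<^sub>m k) * F"
    using Suc.IH by (simp add: k_def del: pow_mat.simps)
  also have "\<dots> = (E * ?T + E * (L k * Z (Suc k) * F ^\<^sub>m k)) * F"
    by (rule add_mult_distrib_mat[symmetric, OF mult_carrier_mat[OF E T] mult_carrier_mat[OF E LZ] F])
  also have "\<dots> = E * power_sum q p k L (\<lambda>i. Z (Suc i)) F * F"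
    using mult_add_distrib_mat[OF E T LZ] by (simp add: power_sum_Suc[OF L Z F] k_def del: pow_mat.simps)
  finally show ?case by (simp only: k_def)
qed

text \<open>Links the merged sum used in the proofs to the two parity sums of the theorem, by
  splitting the index set entry by entry.\<close>

lemma finsum_mat_parity:
  assumes K: "\<And>i. K i \<in> carrier_mat q m" and Z: "Z1 \<in> carrier_mat m p" "Z2 \<in> carrier_mat m p"
    and F: "F \<in> carrier_mat p p"
  shows "power_sum q p w K (alternate Z1 Z2) F =
    finsum_mat q p (\<lambda>i. K i * Z1 * F ^\<^sub>m i) {i. i \<le> w \<and> even i} +
    finsum_mat q p (\<lambda>i. K i * Z2 * F ^\<^sub>m i) {i. i \<le> w \<and> odd i}"
proof -
  have car: "K i * Z * F ^\<^sub>m i \<in> carrier_mat q p" if "Z \<in> carrier_mat m p" for i Z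
    using mult_carrier_mat[OF mult_carrier_mat[OF K that] pow_carrier_mat[OF F]] .
  note alt = alternate_carrier_mat[OF Z]
  have "{..w} = {i. i \<le> w \<and> even i} \<union> {i. i \<le> w \<and> odd i}" by auto
  then have split: "(\<Sum>i\<le>w. f i) = (\<Sum>i | i \<le> w \<and> even i. f i) + (\<Sum>i | i \<le> w \<and> odd i. f i)"
    for f :: "nat \<Rightarrow> complex" by (simp add: sum.union_disjoint[symmetric] disjoint_iff)
  note c = finsum_mat_carrier[of "{i. i \<le> w \<and> even i}" "\<lambda>i. K i * Z1 * F ^\<^sub>m i" q p, OF car[OF Z(1)]]
    finsum_mat_carrier[of "{i. i \<le> w \<and> odd i}" "\<lambda>i. K i * Z2 * F ^\<^sub>m i" q p, OF car[OF Z(2)]]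
    power_sum_carrier[of K q m "alternate Z1 Z2" p F w, OF K alt F]
  have fin: "finite {i. i \<le> w \<and> even i}" "finite {i. i \<le> w \<and> odd i}" by auto
  show ?thesis
  proof (rule eq_matI)
    fix a b
    assume "a < dim_row (finsum_mat q p (\<lambda>i. K i * Z1 * F ^\<^sub>m i) {i. i \<le> w \<and> even i} +
        finsum_mat q p (\<lambda>i. K i * Z2 * F ^\<^sub>m i) {i. i \<le> w \<and> odd i})"
      "b < dim_col (finsum_mat q p (\<lambda>i. K i * Z1 * F ^\<^sub>m i) {i. i \<le> w \<and> even i} +
        finsum_mat q p (\<lambda>i. K i * Z2 * F ^\<^sub>m i) {i. i \<le> w \<and> odd i})"
    then have ab: "a < q" "b < p" using c by auto
    have "power_sum q p w K (alternate Z1 Z2) F $$ (a, b) =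
        (\<Sum>i\<le>w. (K i * alternate Z1 Z2 i * F ^\<^sub>m i) $$ (a, b))"
      unfolding power_sum_def by (rule finsum_mat_index) (use car alt ab in auto)
    also have "\<dots> = (\<Sum>i | i \<le> w \<and> even i. (K i * Z1 * F ^\<^sub>m i) $$ (a, b)) +
        (\<Sum>i | i \<le> w \<and> odd i. (K i * Z2 * F ^\<^sub>m i) $$ (a, b))"
      unfolding split by (intro arg_cong2[where f = "(+)"] sum.cong) (auto simp: alternate_def)
    also have "\<dots> = finsum_mat q p (\<lambda>i. K i * Z1 * F ^\<^sub>m i) {i. i \<le> w \<and> even i} $$ (a, b) +
        finsum_mat q p (\<lambda>i. K i * Z2 * F ^\<^sub>m i) {i. i \<le> w \<and> odd i} $$ (a, b)"
      unfolding finsum_mat_index[OF fin(1) car[OF Z(1)] ab] finsum_mat_index[OF fin(2) car[OF Z(2)] ab] ..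
    finally show "power_sum q p w K (alternate Z1 Z2) F $$ (a, b) =
        (finsum_mat q p (\<lambda>i. K i * Z1 * F ^\<^sub>m i) {i. i \<le> w \<and> even i} +
         finsum_mat q p (\<lambda>i. K i * Z2 * F ^\<^sub>m i) {i. i \<le> w \<and> odd i}) $$ (a, b)"
      using c ab by simp
  qed (use c in auto)
qed

section \<open>Coupled Sylvester equations\<close>

text \<open>This is the single column of \<open>power_sum\<close> when \<open>F\<close> is the 1 by
  1 matrix with entry \<open>s\<close>; it parametrizes the kernel of the pencil at
  \<open>s\<close>.\<close>

definition column_sum ::
    "nat \<Rightarrow> nat \<Rightarrow> (nat \<Rightarrow> complex mat) \<Rightarrow> complex \<Rightarrow> complex vec \<Rightarrow> complex vec \<Rightarrow> complex vec" where
  "column_sum q w K s z1 z2 = vec q (\<lambda>a. \<Sum>i\<le>w. s ^ i * (K i *\<^sub>v alternate z1 z2 i) $ a)"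

text \<open>In column \<open>k\<close> of \<open>V * U\<close>, terms with \<open>l < k\<close>
  vanish because of \<open>V\<close> and terms with \<open>l > k\<close> because of
  \<open>U\<close>. The first nonzero column therefore sees only the eigenvalue on the
  diagonal.\<close>

lemma col_upper_triangular_mult:
  fixes E :: "'a :: field mat"
  assumes U: "U \<in> carrier_mat p p" "upper_triangular U" and E: "E \<in> carrier_mat n q"
    and V: "V \<in> carrier_mat q p" and k: "k < p"
    and V0: "\<And>a b. a < q \<Longrightarrow> b < k \<Longrightarrow> V $$ (a, b) = 0"
  shows "col (E * V * U) k = U $$ (k, k) \<cdot>\<^sub>v (E *\<^sub>v col V k)"
proof -
  let ?s = "U $$ (k, k)"
  have "V *\<^sub>v col U k = ?s \<cdot>\<^sub>v col V k"
  proof (rule eq_vecI)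
    fix a assume "a < dim_vec (?s \<cdot>\<^sub>v col V k)"
    then have a: "a < q" using V by simp
    have "(V *\<^sub>v col U k) $ a = (\<Sum>l<p. V $$ (a, l) * U $$ (l, k))"
      using V U a k by (simp add: scalar_prod_def atLeast0LessThan)
    also have "\<dots> = (\<Sum>l<p. if l = k then V $$ (a, k) * ?s else 0)"
    proof (rule sum.cong[OF refl])
      fix l assume l: "l \<in> {..<p}"
      have "U $$ (l, k) = 0" if "k < l" using U l that by (intro upper_triangularD) auto
      then show "V $$ (a, l) * U $$ (l, k) = (if l = k then V $$ (a, k) * ?s else 0)"
        using V0[OF a, of l] by (cases l k rule: linorder_cases) auto
    qed
    also have "\<dots> = (?s \<cdot>\<^sub>v col V k) $ a" using k a V by simp
    finally show "(V *\<^sub>v col U k) $ a = (?s \<cdot>\<^sub>v col V k) $ a" .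
  qed (use V in auto)
  moreover have "col (E * V * U) k = E *\<^sub>v (V *\<^sub>v col U k)"
  proof -
    have "col (E * V * U) k = E * V *\<^sub>v col U k"
      using col_mult2[OF mult_carrier_mat[OF E V] U(1) k] by simp
    then show ?thesis using assoc_mult_mat_vec[OF E V, of "col U k"] U k by simp
  qed
  ultimately show ?thesis using mult_mat_vec[OF E col_carrier_vec[OF k V], of ?s] by simp
qed

text \<open>Intended reading: \<open>C = [A2 B2]\<close>, \<open>C'\<close> its conjugate,
  \<open>E = [I 0]\<close>, and \<open>K\<close>, \<open>L\<close> the stacked coefficients and
  their conjugates. The equations are the factorization compared power by power. They are symmetric
  under exchanging \<open>(C, K)\<close> with \<open>(C', L)\<close>.\<close>

locale coupled_pencil =
  fixes n m q w :: nat and C C' E :: "complex mat" and K L :: "nat \<Rightarrow> complex mat"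
  assumes C: "C \<in> carrier_mat n q" and C': "C' \<in> carrier_mat n q" and E: "E \<in> carrier_mat n q"
    and K: "\<And>i. K i \<in> carrier_mat q m" and L: "\<And>i. L i \<in> carrier_mat q m"
    and C_K_0: "C * K 0 = 0\<^sub>m n m" and C_K_Suc: "\<And>i. C * K (Suc i) = E * L i"
    and C'_L_0: "C' * L 0 = 0\<^sub>m n m" and C'_L_Suc: "\<And>i. C' * L (Suc i) = E * K i"
    and E_K_top: "E * K w = 0\<^sub>m n m" and E_L_top: "E * L w = 0\<^sub>m n m"
begin

text \<open>Both equations are \<open>power_sum_shift\<close>, whose boundary term vanishes by
  \<open>E_L_top\<close> or \<open>E_K_top\<close>; \<open>alternate_Suc\<close> exchanges the roles
  of \<open>Z1\<close> and \<open>Z2\<close>.\<close>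

lemma power_sum_solves:
  assumes Z: "Z1 \<in> carrier_mat m p" "Z2 \<in> carrier_mat m p" and F: "F \<in> carrier_mat p p"
  shows "C * power_sum q p w K (alternate Z1 Z2) F = E * power_sum q p w L (alternate Z2 Z1) F * F"
    and "C' * power_sum q p w L (alternate Z2 Z1) F = E * power_sum q p w K (alternate Z1 Z2) F * F"
proof -
  note alt = alternate_carrier_mat[where 'a = complex]
  have drop: "A + 0\<^sub>m n m * Y * F ^\<^sub>m i = A"
    if "A \<in> carrier_mat n p" "Y \<in> carrier_mat m p" for A Y i
  proof -
    have "F ^\<^sub>m i \<in> carrier_mat p p" using F by auto
    then show ?thesis using that left_mult_zero_mat[of "F ^\<^sub>m i" p p n] by simp
  qed
  note 1 = power_sum_shift[where Z = "alternate Z1 Z2", OF C E K L alt[OF Z] F C_K_0 C_K_Suc, of w]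
  show "C * power_sum q p w K (alternate Z1 Z2) F = E * power_sum q p w L (alternate Z2 Z1) F * F"
    using 1[unfolded E_L_top alternate_Suc
        drop[OF mult_carrier_mat[OF C power_sum_carrier[OF K alt[OF Z] F]] alt[OF Z(2,1)]]]
    by simp
  note 2 = power_sum_shift[where Z = "alternate Z2 Z1", OF C' E L K alt[OF Z(2,1)] F C'_L_0 C'_L_Suc, of w]
  show "C' * power_sum q p w L (alternate Z2 Z1) F = E * power_sum q p w K (alternate Z1 Z2) F * F"
    using 2[unfolded E_K_top alternate_Suc
        drop[OF mult_carrier_mat[OF C' power_sum_carrier[OF L alt[OF Z(2,1)] F]] alt[OF Z]]]
    by simp
qed

text \<open>The 1 by 1 matrix with entry \<open>s\<close> is triangular, so the matrix identities
  specialize to it and their only column is read off.\<close>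

lemma column_sum_solves:
  assumes z: "z1 \<in> carrier_vec m" "z2 \<in> carrier_vec m"
  shows "C *\<^sub>v column_sum q w K s z1 z2 = s \<cdot>\<^sub>v (E *\<^sub>v column_sum q w L s z2 z1)"
    and "C' *\<^sub>v column_sum q w L s z2 z1 = s \<cdot>\<^sub>v (E *\<^sub>v column_sum q w K s z1 z2)"
proof -
  define F where "F = mat 1 1 (\<lambda>_. s)"
  have F: "F \<in> carrier_mat 1 1" "upper_triangular F" and s: "F $$ (0, 0) = s"
    by (auto simp: F_def)
  define Y where "Y z = mat m 1 (\<lambda>(r, j). if j = 0 then z $ r else 0)" for z :: "complex vec"
  have Y: "Y z \<in> carrier_mat m 1" for z by (simp add: Y_def)
  have Yalt: "alternate (Y x) (Y y) = (\<lambda>i. mat m 1 (\<lambda>(r, j). if j = 0 then alternate x y i $ r else 0))"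
    for x y by (intro ext) (auto simp: alternate_def Y_def)
  have col: "col (power_sum q 1 w J (alternate (Y x) (Y y)) F) 0 = column_sum q w J s x y"
    if J: "\<And>i. J i \<in> carrier_mat q m" and x: "x \<in> carrier_vec m" and y: "y \<in> carrier_vec m" for J x y
    using power_sum_column[of J q m "alternate x y" F 1 _ 0 0 w, OF J alternate_carrier_vec[OF x y] F]
      power_sum_carrier[of J q m "alternate (Y x) (Y y)" 1 F w, OF J alternate_carrier_mat[OF Y Y] F(1)]
    by (intro eq_vecI) (auto simp: column_sum_def Yalt s)
  note K' = power_sum_carrier[of K q m "alternate (Y z1) (Y z2)" 1 F w, OF K alternate_carrier_mat[OF Y Y] F(1)]
  note L' = power_sum_carrier[of L q m "alternate (Y z2) (Y z1)" 1 F w, OF L alternate_carrier_mat[OF Y Y] F(1)]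
  note eq = power_sum_solves[OF Y[of z1] Y[of z2] F(1)]
  show "C *\<^sub>v column_sum q w K s z1 z2 = s \<cdot>\<^sub>v (E *\<^sub>v column_sum q w L s z2 z1)"
    using col_upper_triangular_mult[OF F E L', of 0] col_mult2[OF C K', of 0] eq(1)
    by (simp add: col[of K, OF K z] col[of L, OF L z(2,1)] s del: One_nat_def)
  show "C' *\<^sub>v column_sum q w L s z2 z1 = s \<cdot>\<^sub>v (E *\<^sub>v column_sum q w K s z1 z2)"
    using col_upper_triangular_mult[OF F E K', of 0] col_mult2[OF C' L', of 0] eq(2)
    by (simp add: col[of K, OF K z] col[of L, OF L z(2,1)] s del: One_nat_def)
qed

end

text \<open>The added assumption is the converse of \<open>column_sum_solves\<close> at every
  \<open>s\<close>. It is all that the elimination needs to know about controllability and the rank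
  condition.\<close>

locale exact_coupled_pencil = coupled_pencil +
  assumes exact: "\<And>s v1 v2. v1 \<in> carrier_vec q \<Longrightarrow> v2 \<in> carrier_vec q \<Longrightarrow>
      C *\<^sub>v v1 = s \<cdot>\<^sub>v (E *\<^sub>v v2) \<Longrightarrow> C' *\<^sub>v v2 = s \<cdot>\<^sub>v (E *\<^sub>v v1) \<Longrightarrow>
      \<exists>z1 \<in> carrier_vec m. \<exists>z2 \<in> carrier_vec m.
        v1 = column_sum q w K s z1 z2 \<and> v2 = column_sum q w L s z2 z1"
begin

text \<open>The induction runs downwards from \<open>k = p\<close>, where both unknowns are 0 and
  \<open>Z1 = Z2 = 0\<close>. In the step, exactness at the \<open>k\<close>-th diagonal entry
  produces a solution with the same column \<open>k\<close>; subtracting it clears one more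
  column.\<close>

lemma triangular_elimination:
  assumes U: "U \<in> carrier_mat p p" "upper_triangular U"
    and V: "V1 \<in> carrier_mat q p" "V2 \<in> carrier_mat q p"
    and eq: "C * V1 = E * V2 * U" "C' * V2 = E * V1 * U"
    and k: "k \<le> p" and zero: "\<And>a b. a < q \<Longrightarrow> b < k \<Longrightarrow> V1 $$ (a, b) = 0 \<and> V2 $$ (a, b) = 0"
  shows "\<exists>Z1 \<in> carrier_mat m p. \<exists>Z2 \<in> carrier_mat m p.
    V1 = power_sum q p w K (alternate Z1 Z2) U \<and> V2 = power_sum q p w L (alternate Z2 Z1) U"
  using k V eq zero
proof (induction k arbitrary: V1 V2 rule: inc_induct)
  case base
  have 0: "0\<^sub>m m p \<in> carrier_mat m p" by simp
  have alt0: "alternate (0\<^sub>m m p) (0\<^sub>m m p) = (\<lambda>i. 0\<^sub>m m p)" by (auto simp: alternate_def)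
  have S0: "power_sum q p w J (\<lambda>i. 0\<^sub>m m p) U = 0\<^sub>m q p"
    if J: "\<And>i. J i \<in> carrier_mat q m" for J
  proof -
    have "J i * 0\<^sub>m m p * U ^\<^sub>m i = 0\<^sub>m q p" for i
      using right_mult_zero_mat[OF J[of i], of p] left_mult_zero_mat[OF pow_carrier_mat[OF U(1), of i], of q]
      by simp
    then have "power_sum q p w J (\<lambda>i. 0\<^sub>m m p) U = finsum_mat q p (\<lambda>i. 0\<^sub>m q p) {..w}"
      by (simp add: power_sum_def)
    also have "\<dots> = 0\<^sub>m q p"
      using finsum_mat_carrier[of "{..w}" "\<lambda>i. 0\<^sub>m q p :: complex mat" q p]
      by (intro eq_matI) (auto simp: finsum_mat_index)
    finally show ?thesis .
  qed
  have "V1 = 0\<^sub>m q p" "V2 = 0\<^sub>m q p" using base by (auto intro!: eq_matI)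
  then show ?case using S0[of K, OF K] S0[of L, OF L] by (intro bexI[OF _ 0]) (simp add: alt0)
next
  case (step k)
  note V = step.prems(1,2) and eq = step.prems(3,4) and zero = step.prems(5)
  have kp: "k < p" using step by simp
  define s where "s = U $$ (k, k)"
  have "C *\<^sub>v col V1 k = s \<cdot>\<^sub>v (E *\<^sub>v col V2 k)" "C' *\<^sub>v col V2 k = s \<cdot>\<^sub>v (E *\<^sub>v col V1 k)"
    using col_upper_triangular_mult[OF U E V(1) kp] col_upper_triangular_mult[OF U E V(2) kp] zero eq col_mult2[OF C V(1) kp] col_mult2[OF C' V(2) kp]
    by (simp_all add: s_def)
  then obtain z1 z2 where z: "z1 \<in> carrier_vec m" "z2 \<in> carrier_vec m"
    and z12: "col V1 k = column_sum q w K s z1 z2" "col V2 k = column_sum q w L s z2 z1"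
    using exact[OF col_carrier_vec[OF kp V(1)] col_carrier_vec[OF kp V(2)]] by blast
  have z1: "V1 $$ (a, k) = (\<Sum>i\<le>w. s ^ i * (K i *\<^sub>v alternate z1 z2 i) $ a)"
    and z2: "V2 $$ (a, k) = (\<Sum>i\<le>w. s ^ i * (L i *\<^sub>v alternate z2 z1 i) $ a)" if "a < q" for a
    using arg_cong[OF z12(1), of "\<lambda>v. v $ a"] arg_cong[OF z12(2), of "\<lambda>v. v $ a"] that V kp
    by (simp_all add: column_sum_def)
  \<comment> \<open>\<open>Y z\<close> places \<open>z\<close> in column \<open>k\<close>, so the
    resulting solution reproduces that column of \<open>V1\<close> and \<open>V2\<close>.\<close>
  define Y where "Y z = mat m p (\<lambda>(r, j). if j = k then z $ r else 0)" for z :: "complex vec"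
  have Y: "Y z \<in> carrier_mat m p" for z by (simp add: Y_def)
  have Yalt: "alternate (Y x) (Y y) = (\<lambda>i. mat m p (\<lambda>(r, j). if j = k then alternate x y i $ r else 0))"
    for x y by (intro ext) (auto simp: alternate_def Y_def)
  note alt = alternate_carrier_mat[where 'a = complex] and altz = alternate_carrier_vec[where 'a = complex]
  define S1 where "S1 = power_sum q p w K (alternate (Y z1) (Y z2)) U"
  define S2 where "S2 = power_sum q p w L (alternate (Y z2) (Y z1)) U"
  have S: "S1 \<in> carrier_mat q p" "S2 \<in> carrier_mat q p"
    unfolding S1_def S2_def by (rule power_sum_carrier[OF K alt[OF Y Y] U(1)]
        power_sum_carrier[OF L alt[OF Y Y] U(1)])+
  have Seq: "C * S1 = E * S2 * U" "C' * S2 = E * S1 * U"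
    unfolding S1_def S2_def by (rule power_sum_solves[OF Y Y U(1)])+
  \<comment> \<open>Left of column \<open>k\<close> both sides are 0; in column \<open>k\<close>
    they agree by the choice of \<open>z1\<close> and \<open>z2\<close>. Columns further right may
    differ and are handled by the induction hypothesis.\<close>
  have S0: "S1 $$ (a, b) = V1 $$ (a, b) \<and> S2 $$ (a, b) = V2 $$ (a, b)" if "a < q" "b < Suc k" for a b
    using power_sum_column[OF K altz[OF z] U that(1) kp, of b w]
      power_sum_column[OF L altz[OF z(2,1)] U that(1) kp, of b w] that zero[of a b]
    by (auto simp: S1_def S2_def Yalt z1 z2 s_def)
  have diff: "E * (W - T) * U = E * W * U - E * T * U"
    if "W \<in> carrier_mat q p" "T \<in> carrier_mat q p" for W T
    using mult_minus_distrib_mat[OF E that]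
      minus_mult_distrib_mat[OF mult_carrier_mat[OF E that(1)] mult_carrier_mat[OF E that(2)] U(1)]
    by simp
  have "\<exists>Z1 \<in> carrier_mat m p. \<exists>Z2 \<in> carrier_mat m p.
    V1 - S1 = power_sum q p w K (alternate Z1 Z2) U \<and> V2 - S2 = power_sum q p w L (alternate Z2 Z1) U"
  proof (rule step.IH)
    show "C * (V1 - S1) = E * (V2 - S2) * U"
      using mult_minus_distrib_mat[OF C V(1) S(1)] diff[OF V(2) S(2)] eq Seq by simp
    show "C' * (V2 - S2) = E * (V1 - S1) * U"
      using mult_minus_distrib_mat[OF C' V(2) S(2)] diff[OF V(1) S(1)] eq Seq by simp
    show "(V1 - S1) $$ (a, b) = 0 \<and> (V2 - S2) $$ (a, b) = 0" if "a < q" "b < Suc k" for a b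
      using S0[OF that] S that kp by simp
  qed (use V S in auto)
  then obtain Z1 Z2 where Z: "Z1 \<in> carrier_mat m p" "Z2 \<in> carrier_mat m p"
    and VS: "V1 - S1 = power_sum q p w K (alternate Z1 Z2) U" "V2 - S2 = power_sum q p w L (alternate Z2 Z1) U"
    by blast
  \<comment> \<open>Representations add: the matrices for the remainder plus the single-column
    correction represent the original pair.\<close>
  have altadd: "alternate (A + A') (B + B') = (\<lambda>i. alternate A B i + alternate A' B' i)"
    for A A' B B' :: "complex mat" by (auto simp: alternate_def)
  have cancel: "(W - T) + T = W" if "W \<in> carrier_mat q p" "T \<in> carrier_mat q p" for W T :: "complex mat"
    using that by (intro eq_matI) auto
  show ?case
  proof (intro bexI conjI)
    show "V1 = power_sum q p w K (alternate (Z1 + Y z1) (Z2 + Y z2)) U"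
      unfolding altadd power_sum_add[OF K alt[OF Z] alt[OF Y Y] U(1)]
      using cancel[OF V(1) S(1), unfolded VS(1)] unfolding S1_def by (rule sym)
    show "V2 = power_sum q p w L (alternate (Z2 + Y z2) (Z1 + Y z1)) U"
      unfolding altadd power_sum_add[OF L alt[OF Z(2,1)] alt[OF Y Y] U(1)]
      using cancel[OF V(2) S(2), unfolded VS(2)] unfolding S2_def by (rule sym)
  qed (use Z Y in auto)
qed

text \<open>Over the complex numbers \<open>F\<close> is similar to a triangular \<open>U\<close>.
  Right multiplication by \<open>P\<close> turns solutions for \<open>F\<close> into solutions for
  \<open>U\<close>, and multiplying the resulting \<open>Z1\<close>, \<open>Z2\<close> by
  \<open>Q\<close> undoes the change of basis.\<close>

lemma solutions:
  assumes F: "F \<in> carrier_mat p p"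
    and V: "V1 \<in> carrier_mat q p" "V2 \<in> carrier_mat q p"
  shows "C * V1 = E * V2 * F \<and> C' * V2 = E * V1 * F \<longleftrightarrow>
    (\<exists>Z1 \<in> carrier_mat m p. \<exists>Z2 \<in> carrier_mat m p.
      V1 = power_sum q p w K (alternate Z1 Z2) F \<and> V2 = power_sum q p w L (alternate Z2 Z1) F)"
proof
  assume eq: "C * V1 = E * V2 * F \<and> C' * V2 = E * V1 * F"
  obtain as where "char_poly F = (\<Prod>a\<leftarrow>as. [:- a, 1:])" using char_poly_factorized[OF F] by blast
  from schur_decomposition_exists[OF F this] obtain U where
    U: "U \<in> carrier_mat p p" "upper_triangular U" and sim: "similar_mat F U" by blast
  from sim obtain P Q where wit: "similar_mat_wit F U P Q" unfolding similar_mat_def by blast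
  note w = similar_mat_witD2[OF F wit]
  have P: "P \<in> carrier_mat p p" and Q: "Q \<in> carrier_mat p p" and PQ: "P * Q = 1\<^sub>m p"
    and QP: "Q * P = 1\<^sub>m p" and FPUQ: "F = P * U * Q" using w by auto
  have FP: "F * P = P * U"
    using assoc_mult_mat[OF mult_carrier_mat[OF P U(1)] Q P] right_mult_one_mat[OF mult_carrier_mat[OF P U(1)]]
    by (simp add: FPUQ QP)
  have QF: "Q * F ^\<^sub>m i = U ^\<^sub>m i * Q" for i
  proof -
    have Ui: "U ^\<^sub>m i \<in> carrier_mat p p" using U by auto
    have "Q * F ^\<^sub>m i = Q * (P * (U ^\<^sub>m i * Q))"
      using similar_mat_wit_pow_id[OF wit, of i] assoc_mult_mat[OF P Ui Q] by simp
    also have "\<dots> = Q * P * (U ^\<^sub>m i * Q)"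
      by (rule assoc_mult_mat[symmetric, OF Q P mult_carrier_mat[OF Ui Q]])
    also have "\<dots> = U ^\<^sub>m i * Q"
      using left_mult_one_mat[OF mult_carrier_mat[OF Ui Q]] by (simp add: QP)
    finally show ?thesis .
  qed
  have conj: "D * (V * P) = E * (W * P) * U"
    if "D * V = E * W * F" and D: "D \<in> carrier_mat n q" and Vc: "V \<in> carrier_mat q p"
      and Wc: "W \<in> carrier_mat q p" for D V W
  proof -
    have "D * (V * P) = E * W * F * P" using assoc_mult_mat[OF D Vc P] that(1) by simp
    also have "\<dots> = E * W * (P * U)"
      using assoc_mult_mat[OF mult_carrier_mat[OF E Wc] F P] by (simp add: FP)
    also have "\<dots> = E * W * P * U"
      by (rule assoc_mult_mat[symmetric, OF mult_carrier_mat[OF E Wc] P U(1)])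
    also have "E * W * P = E * (W * P)" by (rule assoc_mult_mat[OF E Wc P])
    finally show ?thesis .
  qed
  \<comment> \<open>With \<open>k = 0\<close> the assumption on vanishing columns is
    vacuous.\<close>
  from triangular_elimination[OF U mult_carrier_mat[OF V(1) P] mult_carrier_mat[OF V(2) P]
      conj[OF conjunct1[OF eq] C V] conj[OF conjunct2[OF eq] C' V(2,1)], of 0]
  obtain Z1 Z2 where Z: "Z1 \<in> carrier_mat m p" "Z2 \<in> carrier_mat m p"
    and VP: "V1 * P = power_sum q p w K (alternate Z1 Z2) U" "V2 * P = power_sum q p w L (alternate Z2 Z1) U"
    by auto
  note alt = alternate_carrier_mat[where 'a = complex]
  have altmult: "alternate (A * Q) (B * Q) = (\<lambda>i. alternate A B i * Q)" for A B
    by (auto simp: alternate_def)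
  have cancel: "W * P * Q = W" if "W \<in> carrier_mat q p" for W
    using assoc_mult_mat[OF that P Q] right_mult_one_mat[OF that] by (simp add: PQ)
  show "\<exists>Z1 \<in> carrier_mat m p. \<exists>Z2 \<in> carrier_mat m p.
      V1 = power_sum q p w K (alternate Z1 Z2) F \<and> V2 = power_sum q p w L (alternate Z2 Z1) F"
  proof (intro bexI conjI)
    show "V1 = power_sum q p w K (alternate (Z1 * Q) (Z2 * Q)) F"
      unfolding altmult power_sum_intertwine[OF K alt[OF Z] F U(1) Q QF]
      using cancel[OF V(1)] by (simp flip: VP)
    show "V2 = power_sum q p w L (alternate (Z2 * Q) (Z1 * Q)) F"
      unfolding altmult power_sum_intertwine[OF L alt[OF Z(2,1)] F U(1) Q QF]
      using cancel[OF V(2)] by (simp flip: VP)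
  qed (use mult_carrier_mat[OF Z(1) Q] mult_carrier_mat[OF Z(2) Q] in auto)
qed (use power_sum_solves[OF _ _ F] in auto)

end

text \<open>The pair \<open>v1 @\<^sub>v v2\<close> lies in the kernel of the \<open>2n\<close> by
  \<open>2q\<close> pencil \<open>M\<close>. By \<open>left\<close>, \<open>M\<close> has full row
  rank; by \<open>inj\<close>, the \<open>2m\<close> columns of \<open>W\<close> are independent;
  they lie in the kernel, and \<open>2q = 2n + 2m\<close>, so they span it.\<close>

lemma (in coupled_pencil) exactI:
  fixes Ke Le :: "complex \<Rightarrow> complex mat"
  assumes dims: "q = n + m"
    and Ke: "\<And>s. Ke s \<in> carrier_mat q m" and Le: "\<And>s. Le s \<in> carrier_mat q m"
    and Ke_sum: "\<And>s a c. a < q \<Longrightarrow> c < m \<Longrightarrow> Ke s $$ (a, c) = (\<Sum>i\<le>w. K i $$ (a, c) * s ^ i)"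
    and Le_sum: "\<And>s a c. a < q \<Longrightarrow> c < m \<Longrightarrow> Le s $$ (a, c) = (\<Sum>i\<le>w. L i $$ (a, c) * s ^ i)"
    and left: "\<And>s u1 u2. u1 \<in> carrier_vec n \<Longrightarrow> u2 \<in> carrier_vec n \<Longrightarrow>
      transpose_mat C *\<^sub>v u2 = s \<cdot>\<^sub>v (transpose_mat E *\<^sub>v u1) \<Longrightarrow>
      transpose_mat C' *\<^sub>v u1 = s \<cdot>\<^sub>v (transpose_mat E *\<^sub>v u2) \<Longrightarrow> u1 = 0\<^sub>v n \<and> u2 = 0\<^sub>v n"
    and inj: "\<And>s b. b \<in> carrier_vec (m + m) \<Longrightarrow>
      four_block_mat (Ke s) (- Ke (- s)) (Le s) (Le (- s)) *\<^sub>v b = 0\<^sub>v (q + q) \<Longrightarrow> b = 0\<^sub>v (m + m)"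
  shows "exact_coupled_pencil n m q w C C' E K L"
proof
  fix s v1 v2
  assume v: "v1 \<in> carrier_vec q" "v2 \<in> carrier_vec q"
    and eq: "C *\<^sub>v v1 = s \<cdot>\<^sub>v (E *\<^sub>v v2)" "C' *\<^sub>v v2 = s \<cdot>\<^sub>v (E *\<^sub>v v1)"
  define W where "W = four_block_mat (Ke s) (- Ke (- s)) (Le s) (Le (- s))"
  define M where "M = four_block_mat (s \<cdot>\<^sub>m E) (- C') (- C) (s \<cdot>\<^sub>m E)"
  have W: "W \<in> carrier_mat (q + q) (m + m)"
    unfolding W_def by (rule four_block_carrier_mat[OF Ke Le])
  have sE: "s \<cdot>\<^sub>m E \<in> carrier_mat n q" and mC: "- C \<in> carrier_mat n q" "- C' \<in> carrier_mat n q"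
    using E C C' by auto
  have M: "M \<in> carrier_mat (n + n) (q + q)"
    unfolding M_def by (rule four_block_carrier_mat[OF sE sE])
  have split: "\<exists>a b. c = a @\<^sub>v b \<and> a \<in> carrier_vec k \<and> b \<in> carrier_vec l"
    if "c \<in> carrier_vec (k + l)" for c :: "complex vec" and k l
    using that vec_first_last_append by (metis vec_first_carrier vec_last_carrier)
  have smult: "(s \<cdot>\<^sub>m E) *\<^sub>v x = s \<cdot>\<^sub>v (E *\<^sub>v x)" if "x \<in> carrier_vec q" for x
    using E that by (intro eq_vecI) auto
  have Mv: "M *\<^sub>v (x @\<^sub>v y) = (s \<cdot>\<^sub>v (E *\<^sub>v x) - C' *\<^sub>v y) @\<^sub>v (s \<cdot>\<^sub>v (E *\<^sub>v y) - C *\<^sub>v x)"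
    if xy: "x \<in> carrier_vec q" "y \<in> carrier_vec q" for x y
    unfolding M_def four_block_mat_mult_vec[OF sE mC(2) mC(1) sE xy] smult[OF xy(1)] smult[OF xy(2)]
    using xy C C' E by (intro eq_vecI) auto
  have Mv0: "M *\<^sub>v (x @\<^sub>v y) = 0\<^sub>v (n + n)"
    if "x \<in> carrier_vec q" "y \<in> carrier_vec q" "C *\<^sub>v x = s \<cdot>\<^sub>v (E *\<^sub>v y)" "C' *\<^sub>v y = s \<cdot>\<^sub>v (E *\<^sub>v x)" for x y
    unfolding Mv[OF that(1,2)] that(3,4) using E that(1,2) by (intro eq_vecI) auto
  have mult: "(Je t *\<^sub>v x) $ a = (\<Sum>i\<le>w. t ^ i * (J i *\<^sub>v x) $ a)"
    if "Je t \<in> carrier_mat q m" and J: "\<And>i. J i \<in> carrier_mat q m" and x: "x \<in> carrier_vec m" and a: "a < q"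
      and sum: "\<And>c. c < m \<Longrightarrow> Je t $$ (a, c) = (\<Sum>i\<le>w. J i $$ (a, c) * t ^ i)"
    for Je J and t :: complex and x a
  proof -
    have "(Je t *\<^sub>v x) $ a = (\<Sum>c<m. (\<Sum>i\<le>w. J i $$ (a, c) * t ^ i) * x $ c)"
      using that(1) x a sum by (simp add: scalar_prod_def atLeast0LessThan)
    also have "\<dots> = (\<Sum>i\<le>w. \<Sum>c<m. t ^ i * (J i $$ (a, c) * x $ c))"
      unfolding sum_distrib_right by (subst sum.swap, intro sum.cong refl) (simp only: ac_simps)
    also have "\<dots> = (\<Sum>i\<le>w. t ^ i * (J i *\<^sub>v x) $ a)"
      using carrier_matD[OF J] x a by (simp add: scalar_prod_def atLeast0LessThan sum_distrib_left)
    finally show ?thesis .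
  qed
  \<comment> \<open>The sign of \<open>(- s) ^ i\<close> depends on the parity of \<open>i\<close>:
    in the upper block even powers meet \<open>x - y\<close> and odd powers \<open>x + y\<close>, in
    the lower block the reverse. Hence \<open>z1 = x - y\<close> and
    \<open>z2 = x + y\<close>.\<close>
  have Wv: "W *\<^sub>v (x @\<^sub>v y) = column_sum q w K s (x - y) (x + y) @\<^sub>v column_sum q w L s (x + y) (x - y)"
    if xy: "x \<in> carrier_vec m" "y \<in> carrier_vec m" for x y
  proof -
    have "W *\<^sub>v (x @\<^sub>v y) =
        (Ke s *\<^sub>v x + (- Ke (- s)) *\<^sub>v y) @\<^sub>v (Le s *\<^sub>v x + Le (- s) *\<^sub>v y)"
      unfolding W_def using Ke[of "- s"] by (intro four_block_mat_mult_vec[OF Ke _ Le Le xy]) auto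
    moreover have "Ke s *\<^sub>v x + (- Ke (- s)) *\<^sub>v y = column_sum q w K s (x - y) (x + y)"
    proof (rule eq_vecI)
      fix a assume "a < dim_vec (column_sum q w K s (x - y) (x + y))"
      then have a: "a < q" by (simp add: column_sum_def)
      have "s ^ i * (K i *\<^sub>v x) $ a - (- s) ^ i * (K i *\<^sub>v y) $ a =
          s ^ i * (K i *\<^sub>v alternate (x - y) (x + y) i) $ a" for i
        using K[of i] xy a mult_add_distrib_mat_vec[OF K xy, of i] mult_minus_distrib_mat_vec[OF K xy, of i]
        by (auto simp: alternate_def algebra_simps simp del: index_mult_mat_vec)
      then show "(Ke s *\<^sub>v x + (- Ke (- s)) *\<^sub>v y) $ a = column_sum q w K s (x - y) (x + y) $ a"
        using mult[OF Ke K xy(1) a Ke_sum[OF a], where t = s] mult[OF Ke K xy(2) a Ke_sum[OF a], where t = "- s"]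
          a Ke[of s] Ke[of "- s"] xy
        by (simp add: column_sum_def sum_subtractf[symmetric] del: index_mult_mat_vec)
    qed (use Ke in \<open>auto simp: column_sum_def\<close>)
    moreover have "Le s *\<^sub>v x + Le (- s) *\<^sub>v y = column_sum q w L s (x + y) (x - y)"
    proof (rule eq_vecI)
      fix a assume "a < dim_vec (column_sum q w L s (x + y) (x - y))"
      then have a: "a < q" by (simp add: column_sum_def)
      have "s ^ i * (L i *\<^sub>v x) $ a + (- s) ^ i * (L i *\<^sub>v y) $ a =
          s ^ i * (L i *\<^sub>v alternate (x + y) (x - y) i) $ a" for i
        using L[of i] xy a mult_add_distrib_mat_vec[OF L xy, of i] mult_minus_distrib_mat_vec[OF L xy, of i]
        by (auto simp: alternate_def algebra_simps simp del: index_mult_mat_vec)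
      then show "(Le s *\<^sub>v x + Le (- s) *\<^sub>v y) $ a = column_sum q w L s (x + y) (x - y) $ a"
        using mult[OF Le L xy(1) a Le_sum[OF a], where t = s] mult[OF Le L xy(2) a Le_sum[OF a], where t = "- s"]
          a Le[of s] Le[of "- s"] xy
        by (simp add: column_sum_def sum.distrib[symmetric] del: index_mult_mat_vec)
    qed (use Le in \<open>auto simp: column_sum_def\<close>)
    ultimately show ?thesis by simp
  qed
  have MW: "M *\<^sub>v (W *\<^sub>v b) = 0\<^sub>v (n + n)" if b: "b \<in> carrier_vec (m + m)" for b
  proof -
    from split[OF b] obtain x y where bxy: "b = x @\<^sub>v y" and xy: "x \<in> carrier_vec m" "y \<in> carrier_vec m"
      by blast
    have "x - y \<in> carrier_vec m" "x + y \<in> carrier_vec m" using xy by auto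
    note column_sum_solves[OF this, of s]
    then show ?thesis unfolding bxy Wv[OF xy] by (intro Mv0) (auto simp: column_sum_def)
  qed
  \<comment> \<open>Transposing \<open>M\<close> blockwise exchanges the off-diagonal blocks, so
    \<open>C\<close> acts on \<open>u2\<close> and \<open>C'\<close> on \<open>u1\<close>, as in the
    hypothesis \<open>left\<close>.\<close>
  have left': "u = 0\<^sub>v (n + n)"
    if u: "u \<in> carrier_vec (n + n)" and 0: "transpose_mat M *\<^sub>v u = 0\<^sub>v (q + q)" for u
  proof -
    from split[OF u] obtain u1 u2 where uu: "u = u1 @\<^sub>v u2" "u1 \<in> carrier_vec n" "u2 \<in> carrier_vec n"
      by blast
    have MT: "transpose_mat M = four_block_mat (transpose_mat (s \<cdot>\<^sub>m E)) (transpose_mat (- C))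
        (transpose_mat (- C')) (transpose_mat (s \<cdot>\<^sub>m E))"
      unfolding M_def by (rule transpose_four_block_mat[OF sE mC(2) mC(1) sE])
    have "transpose_mat M *\<^sub>v u =
        (s \<cdot>\<^sub>v (transpose_mat E *\<^sub>v u1) - transpose_mat C *\<^sub>v u2) @\<^sub>v
        (s \<cdot>\<^sub>v (transpose_mat E *\<^sub>v u2) - transpose_mat C' *\<^sub>v u1)"
    proof -
      have "transpose_mat (s \<cdot>\<^sub>m E) *\<^sub>v x = s \<cdot>\<^sub>v (transpose_mat E *\<^sub>v x)" if "x \<in> carrier_vec n" for x
        using E that by (intro eq_vecI) auto
      moreover have "transpose_mat (s \<cdot>\<^sub>m E) \<in> carrier_mat q n" "transpose_mat (- C) \<in> carrier_mat q n"
        "transpose_mat (- C') \<in> carrier_mat q n" using E C C' by auto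
      note four_block_mat_mult_vec[OF this(1,2,3,1) uu(2,3)]
      ultimately show ?thesis
        unfolding MT uu(1) using uu(2,3) C C' E by (auto intro!: eq_vecI simp: transpose_uminus)
    qed
    then have z: "(s \<cdot>\<^sub>v (transpose_mat E *\<^sub>v u1) - transpose_mat C *\<^sub>v u2) @\<^sub>v
        (s \<cdot>\<^sub>v (transpose_mat E *\<^sub>v u2) - transpose_mat C' *\<^sub>v u1) = 0\<^sub>v q @\<^sub>v 0\<^sub>v q"
      using 0 by (metis zero_vec_append)
    have "s \<cdot>\<^sub>v (transpose_mat E *\<^sub>v u1) - transpose_mat C *\<^sub>v u2 \<in> carrier_vec q"
      by (rule carrier_vecI) (simp add: carrier_matD[OF C])
    note z12 = z[unfolded append_vec_eq[OF this zero_carrier_vec]]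
    have cancel: "y = x" if "x - y = 0\<^sub>v q" "x \<in> carrier_vec q" "y \<in> carrier_vec q" for x y :: "complex vec"
      using that by (metis carrier_vecD index_minus_vec(1) index_zero_vec(1) eq_iff_diff_eq_0 eq_vecI)
    have "transpose_mat C *\<^sub>v u2 = s \<cdot>\<^sub>v (transpose_mat E *\<^sub>v u1)"
      "transpose_mat C' *\<^sub>v u1 = s \<cdot>\<^sub>v (transpose_mat E *\<^sub>v u2)"
      using cancel[OF conjunct1[OF z12]] cancel[OF conjunct2[OF z12]] C C' E uu by auto
    from left[OF uu(2,3) this] show ?thesis using uu(1) by auto
  qed
  have N: "q + q = (n + n) + (m + m)" using dims by simp
  have v12: "v1 @\<^sub>v v2 \<in> carrier_vec (q + q)" using v by simp
  obtain b where b: "b \<in> carrier_vec (m + m)" and vb: "v1 @\<^sub>v v2 = W *\<^sub>v b"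
    using kernel_eq_range[OF M W N left' inj[of _ s, folded W_def] MW v12 Mv0[OF v eq]] by blast
  from split[OF b] obtain x y where bxy: "b = x @\<^sub>v y" and xy: "x \<in> carrier_vec m" "y \<in> carrier_vec m"
    by blast
  have "v1 = column_sum q w K s (x - y) (x + y) \<and> v2 = column_sum q w L s (x + y) (x - y)"
    using vb append_vec_eq[OF v(1), of "column_sum q w K s (x - y) (x + y)"]
    unfolding bxy Wv[OF xy] by (auto simp: column_sum_def)
  then show "\<exists>z1\<in>carrier_vec m. \<exists>z2\<in>carrier_vec m.
      v1 = column_sum q w K s z1 z2 \<and> v2 = column_sum q w L s z2 z1"
    using xy by (intro bexI[of _ "x - y"] bexI[of _ "x + y"]) auto
qed

section \<open>Polynomial factorizations\<close>

text \<open>Defined through transposes so that its transpose is literally an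
  \<open>append_rows\<close>, which makes the left null vector equations split into blocks at
  once.\<close>

definition append_cols :: "'a::zero mat \<Rightarrow> 'a mat \<Rightarrow> 'a mat" where
  "append_cols A B = transpose_mat (transpose_mat A @\<^sub>r transpose_mat B)"

lemma append_cols_carrier:
  assumes "A \<in> carrier_mat nr n1" "B \<in> carrier_mat nr n2"
  shows "append_cols A B \<in> carrier_mat nr (n1 + n2)"
  using assms by (simp add: append_cols_def)

lemma append_rows_index:
  assumes "A \<in> carrier_mat n1 nc" "B \<in> carrier_mat n2 nc" "i < n1 + n2" "j < nc"
  shows "(A @\<^sub>r B) $$ (i, j) = (if i < n1 then A $$ (i, j) else B $$ (i - n1, j))"
  using assms by (auto simp: append_rows_def)

lemma transpose_append_cols_mult_vec:
  fixes A B :: "'a::comm_ring_1 mat"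
  assumes "A \<in> carrier_mat nr n1" "B \<in> carrier_mat nr n2" "v \<in> carrier_vec nr"
  shows "transpose_mat (append_cols A B) *\<^sub>v v = (transpose_mat A *\<^sub>v v) @\<^sub>v (transpose_mat B *\<^sub>v v)"
  unfolding append_cols_def Matrix.transpose_transpose by (rule mat_mult_append) (use assms in auto)

lemma append_cols_mult_append_rows:
  fixes A B :: "'a::comm_ring_1 mat"
  assumes A: "A \<in> carrier_mat nr n1" and B: "B \<in> carrier_mat nr n2"
    and X: "X \<in> carrier_mat n1 nc" and Y: "Y \<in> carrier_mat n2 nc"
  shows "append_cols A B * (X @\<^sub>r Y) = A * X + B * Y"
proof (rule eq_matI)
  note AB = append_cols_carrier[OF A B]
  note XY = carrier_append_rows[OF X Y]
  fix i j assume "i < dim_row (A * X + B * Y)" "j < dim_col (A * X + B * Y)"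
  then have ij: "i < nr" "j < nc" using B Y by auto
  have AB1: "append_cols A B $$ (i, l) = A $$ (i, l)" if "l < n1" for l
    using append_rows_index[of "transpose_mat A" n1 nr "transpose_mat B" n2 l i] A B ij that
    by (simp add: append_cols_def append_rows_def)
  have AB2: "append_cols A B $$ (i, n1 + l) = B $$ (i, l)" if "l < n2" for l
    using append_rows_index[of "transpose_mat A" n1 nr "transpose_mat B" n2 "n1 + l" i] A B ij that
    by (simp add: append_cols_def append_rows_def)
  have XY1: "(X @\<^sub>r Y) $$ (l, j) = X $$ (l, j)" if "l < n1" for l
    using append_rows_index[OF X Y, of l j] ij that by simp
  have XY2: "(X @\<^sub>r Y) $$ (n1 + l, j) = Y $$ (l, j)" if "l < n2" for l
    using append_rows_index[OF X Y, of "n1 + l" j] ij that by simp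
  have "(append_cols A B * (X @\<^sub>r Y)) $$ (i, j) =
      (\<Sum>l<n1 + n2. append_cols A B $$ (i, l) * (X @\<^sub>r Y) $$ (l, j))"
    by (rule index_mult_mat_sum[OF AB XY ij])
  also have "\<dots> = (\<Sum>l<n1. append_cols A B $$ (i, l) * (X @\<^sub>r Y) $$ (l, j)) +
      (\<Sum>l<n2. append_cols A B $$ (i, n1 + l) * (X @\<^sub>r Y) $$ (n1 + l, j))"
    by (simp add: lessThan_atLeast0 sum.atLeastLessThan_concat[of 0 n1 "n1 + n2", symmetric]
        sum.atLeastLessThan_shift_0[of _ n1 "n1 + n2"])
  also have "\<dots> = (A * X) $$ (i, j) + (B * Y) $$ (i, j)"
    unfolding index_mult_mat_sum[OF A X ij] index_mult_mat_sum[OF B Y ij]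
    by (simp add: AB1 AB2 XY1 XY2)
  finally show "(append_cols A B * (X @\<^sub>r Y)) $$ (i, j) = (A * X + B * Y) $$ (i, j)"
    using B Y ij by simp
qed (use append_cols_carrier[OF A B] carrier_append_rows[OF X Y] B Y in auto)

section \<open>Entrywise conjugation and coefficient comparison\<close>

lemma conj_mat_mult:
  assumes "A \<in> carrier_mat nr n" "B \<in> carrier_mat n nc"
  shows "conj_mat (A * B) = conj_mat A * conj_mat B"
proof -
  interpret semiring_hom cnj by unfold_locales auto
  show ?thesis using assms by (rule mat_hom_mult)
qed

lemma conj_mat_conj_mat: "conj_mat (conj_mat A) = A"
  by (intro eq_matI) auto

lemma conj_mat_inject: "conj_mat A = conj_mat B \<longleftrightarrow> A = B"
  by (metis conj_mat_conj_mat)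

lemma conj_append_rows:
  assumes "A \<in> carrier_mat n1 nc" "B \<in> carrier_mat n2 nc"
  shows "conj_mat (A @\<^sub>r B) = conj_mat A @\<^sub>r conj_mat B"
  using assms by (intro eq_matI) (auto simp: append_rows_def)

lemma conj_append_cols:
  assumes "A \<in> carrier_mat nr n1" "B \<in> carrier_mat nr n2"
  shows "conj_mat (append_cols A B) = append_cols (conj_mat A) (conj_mat B)"
  using assms by (intro eq_matI) (auto simp: append_cols_def append_rows_def)

lemma coeff_const_pmat_mult:
  fixes A :: "complex mat"
  assumes A: "A \<in> carrier_mat nr n" and N: "N \<in> carrier_mat n nc"
  shows "coeff_pmat (const_pmat A * N) i = A * coeff_pmat N i"
  using assms by (intro eq_matI) (auto simp: scalar_prod_def coeff_sum)

text \<open>The factor \<open>s\<close> shifts the coefficients of the conjugated \<open>N\<close>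
  by one: the constant term becomes 0 and the term of index \<open>i + 1\<close> is the conjugate of
  coefficient \<open>i\<close>.\<close>

lemma factorization_coeff:
  fixes A B :: "complex mat"
  assumes A: "A \<in> carrier_mat n n" and B: "B \<in> carrier_mat n m"
    and N: "N \<in> carrier_mat n m" and D: "D \<in> carrier_mat m m"
    and eq: "[:0, 1:] \<cdot>\<^sub>m conj_pmat N - const_pmat A * N = const_pmat B * D"
  shows "A * coeff_pmat N 0 + B * coeff_pmat D 0 = 0\<^sub>m n m"
    and "A * coeff_pmat N (Suc i) + B * coeff_pmat D (Suc i) = conj_mat (coeff_pmat N i)"
proof -
  have "coeff_pmat ([:0, 1:] \<cdot>\<^sub>m conj_pmat N) k - A * coeff_pmat N k = B * coeff_pmat D k" for k
    unfolding coeff_const_pmat_mult[OF A N, symmetric] coeff_const_pmat_mult[OF B D, symmetric] eq[symmetric]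
    using A N by (intro eq_matI) (auto simp del: index_mult_mat(1))
  note diff = this
  have *: "coeff_pmat ([:0, 1:] \<cdot>\<^sub>m conj_pmat N) k = A * coeff_pmat N k + B * coeff_pmat D k" for k
  proof -
    have "M = X + Y" if "M - X = Y" "M \<in> carrier_mat n m" "X \<in> carrier_mat n m" for M X Y :: "complex mat"
      using that by (intro eq_matI) auto
    from this[OF diff] show ?thesis using N mult_carrier_mat[OF A, of "coeff_pmat N k" m] by simp
  qed
  show "A * coeff_pmat N 0 + B * coeff_pmat D 0 = 0\<^sub>m n m"
    unfolding *[of 0, symmetric] using N by (intro eq_matI) auto
  show "A * coeff_pmat N (Suc i) + B * coeff_pmat D (Suc i) = conj_mat (coeff_pmat N i)"
    unfolding *[of "Suc i", symmetric] using N by (intro eq_matI) (auto simp: coeff_map_poly)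
qed

lemma poly_eq_sum_bound:
  fixes f :: "'a::comm_semiring_1 poly"
  assumes "degree f \<le> w"
  shows "poly f s = (\<Sum>i\<le>w. coeff f i * s ^ i)"
  unfolding poly_altdef by (rule sum.mono_neutral_left) (use assms in \<open>auto simp: coeff_eq_0\<close>)

section \<open>The complete solution of the coupled equations\<close>

theorem corollary2:
  fixes n m p \<omega> :: nat
    and \<tau> :: time_domain
    and A2 B2 F1 :: "complex mat"
    and N0 D0 :: "complex poly mat"
  assumes A2: "A2 \<in> carrier_mat n n"
    and B2: "B2 \<in> carrier_mat n m"
    and controllable: "antilinear_controllable \<tau> (conj_mat A2) (conj_mat B2)"
    and F1: "F1 \<in> carrier_mat p p"
    and N0: "N0 \<in> carrier_mat n m"
    and D0: "D0 \<in> carrier_mat m m"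
    and factorization:
      "[:0, 1:] \<cdot>\<^sub>m conj_pmat N0 - const_pmat A2 * N0 = const_pmat B2 * D0"
    and full_rank: "\<And>s :: complex. vec_space.rank (n + m + (n + m)) (four_block_mat
        (eval_pmat N0 s @\<^sub>r eval_pmat D0 s)
        (- (eval_pmat N0 (- s) @\<^sub>r eval_pmat D0 (- s)))
        (eval_pmat (conj_pmat N0) s @\<^sub>r eval_pmat (conj_pmat D0) s)
        (eval_pmat (conj_pmat N0) (- s) @\<^sub>r eval_pmat (conj_pmat D0) (- s))) = 2 * m"
    and degree_N0: "\<And>i j. i < n \<Longrightarrow> j < m \<Longrightarrow> degree (N0 $$ (i, j)) \<le> \<omega>"
    and degree_D0: "\<And>i j. i < m \<Longrightarrow> j < m \<Longrightarrow> degree (D0 $$ (i, j)) \<le> \<omega>"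
  shows "\<forall>X1 \<in> carrier_mat n p. \<forall>X2 \<in> carrier_mat n p.
      \<forall>Y1 \<in> carrier_mat m p. \<forall>Y2 \<in> carrier_mat m p.
      (conj_mat A2 * X2 + conj_mat B2 * Y2 = X1 * F1 \<and>
       conj_mat A2 * conj_mat X1 + conj_mat B2 * conj_mat Y1 = conj_mat X2 * conj_mat F1)
      \<longleftrightarrow>
      (\<exists>Z1 \<in> carrier_mat m p. \<exists>Z2 \<in> carrier_mat m p.
        X1 @\<^sub>r Y1 =
          finsum_mat (n + m) p (\<lambda>i. (coeff_pmat N0 i @\<^sub>r coeff_pmat D0 i) * Z1 * F1 ^\<^sub>m i)
            {i. i \<le> \<omega> \<and> even i} +
          finsum_mat (n + m) p (\<lambda>i. (coeff_pmat N0 i @\<^sub>r coeff_pmat D0 i) * Z2 * F1 ^\<^sub>m i)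
            {i. i \<le> \<omega> \<and> odd i} \<and>
        X2 @\<^sub>r Y2 =
          finsum_mat (n + m) p
            (\<lambda>i. (conj_mat (coeff_pmat N0 i) @\<^sub>r conj_mat (coeff_pmat D0 i)) * Z2 * F1 ^\<^sub>m i)
            {i. i \<le> \<omega> \<and> even i} +
          finsum_mat (n + m) p
            (\<lambda>i. (conj_mat (coeff_pmat N0 i) @\<^sub>r conj_mat (coeff_pmat D0 i)) * Z1 * F1 ^\<^sub>m i)
            {i. i \<le> \<omega> \<and> odd i})"
proof -
  define K where "K i = coeff_pmat N0 i @\<^sub>r coeff_pmat D0 i" for i
  define L where "L i = conj_mat (coeff_pmat N0 i) @\<^sub>r conj_mat (coeff_pmat D0 i)" for i
  define C where "C = append_cols A2 B2"
  define C' where "C' = append_cols (conj_mat A2) (conj_mat B2)"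
  define E where "E = append_cols (1\<^sub>m n :: complex mat) (0\<^sub>m n m)"
  define Ke where "Ke s = eval_pmat N0 s @\<^sub>r eval_pmat D0 s" for s
  define Le where "Le s = eval_pmat (conj_pmat N0) s @\<^sub>r eval_pmat (conj_pmat D0) s" for s
  have A2': "conj_mat A2 \<in> carrier_mat n n" and B2': "conj_mat B2 \<in> carrier_mat n m"
    using A2 B2 by auto
  have Nc: "coeff_pmat N0 i \<in> carrier_mat n m" and Dc: "coeff_pmat D0 i \<in> carrier_mat m m"
    and Nc': "conj_mat (coeff_pmat N0 i) \<in> carrier_mat n m"
    and Dc': "conj_mat (coeff_pmat D0 i) \<in> carrier_mat m m" for i
    using N0 D0 by auto
  have C: "C \<in> carrier_mat n (n + m)" and C': "C' \<in> carrier_mat n (n + m)" and E: "E \<in> carrier_mat n (n + m)"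
    unfolding C_def C'_def E_def using A2 B2 A2' B2' by (auto intro: append_cols_carrier)
  have K: "K i \<in> carrier_mat (n + m) m" and L: "L i \<in> carrier_mat (n + m) m" for i
    unfolding K_def L_def by (rule carrier_append_rows[OF Nc Dc] carrier_append_rows[OF Nc' Dc'])+
  have E_mult: "E * (X @\<^sub>r Y) = X" if X: "X \<in> carrier_mat n k" and Y: "Y \<in> carrier_mat m k" for X Y k
    unfolding E_def append_cols_mult_append_rows[OF one_carrier_mat zero_carrier_mat X Y]
    using X Y by simp
  have conj_K: "conj_mat (K i) = L i" for i
    unfolding K_def L_def by (rule conj_append_rows[OF Nc Dc])
  have conj_C: "conj_mat C = C'"
    unfolding C_def C'_def by (rule conj_append_cols[OF A2 B2])
  have C_K_0: "C * K 0 = 0\<^sub>m n m"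
    unfolding C_def K_def append_cols_mult_append_rows[OF A2 B2 Nc Dc]
    by (rule factorization_coeff[OF A2 B2 N0 D0 factorization])
  have C_K_Suc: "C * K (Suc i) = E * L i" for i
    unfolding C_def K_def L_def append_cols_mult_append_rows[OF A2 B2 Nc Dc] E_mult[OF Nc' Dc']
    by (rule factorization_coeff[OF A2 B2 N0 D0 factorization])
  \<comment> \<open>Conjugation exchanges \<open>K\<close> with \<open>L\<close> and
    \<open>C\<close> with \<open>C'\<close>, so the locale assumptions about \<open>C'\<close> and
    about \<open>E * K \<omega>\<close> follow from those already proved.\<close>
  have E_K: "E * K i = conj_mat (E * L i)" for i
    unfolding K_def L_def E_mult[OF Nc' Dc'] E_mult[OF Nc Dc] conj_mat_conj_mat ..
  have C'_L: "C' * L i = conj_mat (C * K i)" for i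
    unfolding conj_C[symmetric] conj_K[symmetric] by (rule conj_mat_mult[OF C K, symmetric])
  have E_L_top: "E * L \<omega> = 0\<^sub>m n m"
  proof -
    \<comment> \<open>Beyond the degree bound both coefficients vanish. The comparison at index
      \<open>\<omega> + 1\<close> then forces the coefficient of \<open>N0\<close> at
      \<open>\<omega>\<close> to be 0, which removes the boundary term of the telescoping.\<close>
    have "coeff_pmat N0 (Suc \<omega>) = 0\<^sub>m n m" "coeff_pmat D0 (Suc \<omega>) = 0\<^sub>m m m"
      using N0 D0 degree_N0 degree_D0 by (auto intro!: eq_matI coeff_eq_0 simp: less_Suc_eq_le)
    then have "C * K (Suc \<omega>) = 0\<^sub>m n m"
      unfolding C_def K_def append_cols_mult_append_rows[OF A2 B2 Nc Dc] using A2 B2 by simp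
    then show ?thesis by (simp add: C_K_Suc)
  qed
  have conj0: "conj_mat (0\<^sub>m n m) = 0\<^sub>m n m" by (intro eq_matI) auto
  interpret coupled_pencil n m "n + m" \<omega> C C' E K L
    by unfold_locales
      (simp_all only: C C' E K L C_K_0 C_K_Suc C'_L E_K E_L_top conj0)
  have Ke: "Ke s \<in> carrier_mat (n + m) m" and Le: "Le s \<in> carrier_mat (n + m) m" for s
    unfolding Ke_def Le_def using N0 D0 by auto
  interpret exact_coupled_pencil n m "n + m" \<omega> C C' E K L
  proof (rule exactI[of Ke Le])
    show "Ke s $$ (a, c) = (\<Sum>i\<le>\<omega>. K i $$ (a, c) * s ^ i)" if ac: "a < n + m" "c < m" for s a c
      using ac N0 D0 poly_eq_sum_bound[OF degree_N0, of a c s] poly_eq_sum_bound[OF degree_D0, of "a - n" c s]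
      by (auto simp: Ke_def K_def append_rows_def)
    have deg: "degree (map_poly cnj f) \<le> degree f" for f by (rule degree_map_poly_le)
    have degN: "degree (map_poly cnj (N0 $$ (i, j))) \<le> \<omega>" if "i < n" "j < m" for i j
      using deg degree_N0[OF that] by (rule order.trans)
    have degD: "degree (map_poly cnj (D0 $$ (i, j))) \<le> \<omega>" if "i < m" "j < m" for i j
      using deg degree_D0[OF that] by (rule order.trans)
    show "Le s $$ (a, c) = (\<Sum>i\<le>\<omega>. L i $$ (a, c) * s ^ i)" if ac: "a < n + m" "c < m" for s a c
      using ac N0 D0 poly_eq_sum_bound[OF degN, of a c s] poly_eq_sum_bound[OF degD, of "a - n" c s]
      by (auto simp: Le_def L_def append_rows_def coeff_map_poly)
    show "b = 0\<^sub>v (m + m)" if b: "b \<in> carrier_vec (m + m)"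
      and 0: "four_block_mat (Ke s) (- Ke (- s)) (Le s) (Le (- s)) *\<^sub>v b = 0\<^sub>v (n + m + (n + m))" for s b
      by (rule vec_space.full_column_rank_inj[OF four_block_carrier_mat[OF Ke Le] _ b 0])
        (use full_rank[of s] in \<open>simp add: Ke_def Le_def mult_2\<close>)
    show "u1 = 0\<^sub>v n \<and> u2 = 0\<^sub>v n" if u: "u1 \<in> carrier_vec n" "u2 \<in> carrier_vec n"
      and Cu: "transpose_mat C *\<^sub>v u2 = s \<cdot>\<^sub>v (transpose_mat E *\<^sub>v u1)"
      and C'u: "transpose_mat C' *\<^sub>v u1 = s \<cdot>\<^sub>v (transpose_mat E *\<^sub>v u2)" for s u1 u2
    proof -
      have ET: "s \<cdot>\<^sub>v (transpose_mat E *\<^sub>v u) = (s \<cdot>\<^sub>v u) @\<^sub>v 0\<^sub>v m" if "u \<in> carrier_vec n" for u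
        unfolding E_def transpose_append_cols_mult_vec[OF one_carrier_mat zero_carrier_mat that]
        using that by (intro eq_vecI) auto
      \<comment> \<open>The lower block of the transpose of \<open>E\<close> is 0, so each equation
        splits into a state part and an input part. These are the hypotheses of
        \<open>controllable_left_kernel\<close> for the conjugated pair, with \<open>v = u1\<close>
        and \<open>w = u2\<close>.\<close>
      have "transpose_mat A2 *\<^sub>v u2 = s \<cdot>\<^sub>v u1 \<and> transpose_mat B2 *\<^sub>v u2 = 0\<^sub>v m"
        using Cu append_vec_eq[of "transpose_mat A2 *\<^sub>v u2" n "s \<cdot>\<^sub>v u1"] A2 u
        unfolding C_def transpose_append_cols_mult_vec[OF A2 B2 u(2)] ET[OF u(1)] by auto
      moreover have "transpose_mat (conj_mat A2) *\<^sub>v u1 = s \<cdot>\<^sub>v u2 \<and> transpose_mat (conj_mat B2) *\<^sub>v u1 = 0\<^sub>v m"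
        using C'u append_vec_eq[of "transpose_mat (conj_mat A2) *\<^sub>v u1" n "s \<cdot>\<^sub>v u2"] A2 u
        unfolding C'_def transpose_append_cols_mult_vec[OF A2' B2' u(1)] ET[OF u(2)] by auto
      ultimately show ?thesis
        using controllable_left_kernel[OF controllable A2' B2' u, of s] by (simp add: conj_mat_conj_mat)
    qed
  qed (use Ke Le in auto)
  show ?thesis
  proof (intro ballI)
    fix X1 X2 Y1 Y2 :: "complex mat"
    assume X: "X1 \<in> carrier_mat n p" "X2 \<in> carrier_mat n p"
      and Y: "Y1 \<in> carrier_mat m p" "Y2 \<in> carrier_mat m p"
    have eq1: "C' * (X2 @\<^sub>r Y2) = conj_mat A2 * X2 + conj_mat B2 * Y2"
      unfolding C'_def by (rule append_cols_mult_append_rows[OF A2' B2' X(2) Y(2)])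
    have eq2: "conj_mat (C * (X1 @\<^sub>r Y1)) = conj_mat A2 * conj_mat X1 + conj_mat B2 * conj_mat Y1"
    proof -
      have c: "conj_mat X1 \<in> carrier_mat n p" "conj_mat Y1 \<in> carrier_mat m p" using X Y by auto
      show ?thesis
        unfolding conj_mat_mult[OF C carrier_append_rows[OF X(1) Y(1)]] conj_C
          conj_append_rows[OF X(1) Y(1)] C'_def
        by (rule append_cols_mult_append_rows[OF A2' B2' c])
    qed
    \<comment> \<open>The second given equation is the conjugate of
      \<open>C * (X1 @\<^sub>r Y1) = X2 * F1\<close>, and conjugation is injective; the first is
      already the equation for \<open>C'\<close>.\<close>
    have "conj_mat A2 * X2 + conj_mat B2 * Y2 = X1 * F1 \<and>
        conj_mat A2 * conj_mat X1 + conj_mat B2 * conj_mat Y1 = conj_mat X2 * conj_mat F1 \<longleftrightarrow>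
      C * (X1 @\<^sub>r Y1) = E * (X2 @\<^sub>r Y2) * F1 \<and> C' * (X2 @\<^sub>r Y2) = E * (X1 @\<^sub>r Y1) * F1"
      unfolding E_mult[OF X(1) Y(1)] E_mult[OF X(2) Y(2)] eq1 eq2[symmetric]
        conj_mat_mult[OF X(2) F1, symmetric] conj_mat_inject by auto
    also have "\<dots> \<longleftrightarrow> (\<exists>Z1 \<in> carrier_mat m p. \<exists>Z2 \<in> carrier_mat m p.
        X1 @\<^sub>r Y1 = power_sum (n + m) p \<omega> K (alternate Z1 Z2) F1 \<and>
        X2 @\<^sub>r Y2 = power_sum (n + m) p \<omega> L (alternate Z2 Z1) F1)"
      by (rule solutions[OF F1 carrier_append_rows[OF X(1) Y(1)] carrier_append_rows[OF X(2) Y(2)]])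
    finally show "(conj_mat A2 * X2 + conj_mat B2 * Y2 = X1 * F1 \<and>
       conj_mat A2 * conj_mat X1 + conj_mat B2 * conj_mat Y1 = conj_mat X2 * conj_mat F1)
      \<longleftrightarrow>
      (\<exists>Z1 \<in> carrier_mat m p. \<exists>Z2 \<in> carrier_mat m p.
        X1 @\<^sub>r Y1 =
          finsum_mat (n + m) p (\<lambda>i. (coeff_pmat N0 i @\<^sub>r coeff_pmat D0 i) * Z1 * F1 ^\<^sub>m i)
            {i. i \<le> \<omega> \<and> even i} +
          finsum_mat (n + m) p (\<lambda>i. (coeff_pmat N0 i @\<^sub>r coeff_pmat D0 i) * Z2 * F1 ^\<^sub>m i)
            {i. i \<le> \<omega> \<and> odd i} \<and>
        X2 @\<^sub>r Y2 =
          finsum_mat (n + m) p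
            (\<lambda>i. (conj_mat (coeff_pmat N0 i) @\<^sub>r conj_mat (coeff_pmat D0 i)) * Z2 * F1 ^\<^sub>m i)
            {i. i \<le> \<omega> \<and> even i} +
          finsum_mat (n + m) p
            (\<lambda>i. (conj_mat (coeff_pmat N0 i) @\<^sub>r conj_mat (coeff_pmat D0 i)) * Z1 * F1 ^\<^sub>m i)
            {i. i \<le> \<omega> \<and> odd i})"
      unfolding K_def[symmetric] L_def[symmetric]
      by (simp add: finsum_mat_parity[OF K _ _ F1] finsum_mat_parity[OF L _ _ F1])
  qed
qed

end
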